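(* Let $s_1,s_2>1$ satisfy $\frac1{s_1}+\frac1{s_2}<1$ and let $p,q,r>0$ be given. Let $W_a$, $\mu_a$ and $h_a$ be the maps, measures and densities defined in the context. Then the normalized invariant densities $\{h_a\}$ are uniformly bounded for small $a$: there exist $a_0>0$ and $M<\infty$ (depending on $s_1,s_2,p,q,r$) such that $h_a\le M$ Lebesgue-almost everywhere on $[0,1]$ for all $0<a<a_0$. Consequently, $\mu_a$ converges $*$-weakly to $\mu_0$ as $a\to0^+$.
   Context: Fix $s_1,s_2>1$ and $p,q,r>0$. For $a\ge 0$ define $$W_a(x)=\begin{cases} 1-\frac{2(s_1+pa)}{s_1-1+pa-2ra}\,x, & 0\le x<\frac12-\frac{\frac12+ra}{s_1+pa},\\ (s_1+pa)(x-\tfrac12)+\tfrac12+ra, & \frac12-\frac{\frac12+ra}{s_1+pa}\le x<\frac12,\\ -(s_2+qa)(x-\tfrac12)+\tfrac12+ra, & \frac12\le x<\frac12+\frac{\frac12+ra}{s_2+qa},\\ 1+\frac{2(s_2+qa)}{s_2-1+qa-2ra}\,(x-1), & \frac12+\frac{\frac12+ra}{s_2+qa}\le x\le 1.\end{cases}$$ Only those $a\ge 0$ are considered for which $0\le W_a(x)\le 1$ for all $x\in[0,1]$ (this holds for $a=0$ and for all sufficiently small $a>0$). All slopes of $W_a$ exceed $1$ in modulus, and $W_a$ has a unique absolutely continuous (with respect to Lebesgue measure) invariant probability measure $\mu_a$; its normalized density with respect to Lebesgue measure is denoted $h_a$. $*$-weak convergence of probability measures means convergence of integrals of every continuous function on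 $[0,1]$. *)

theory Defs
  imports "HOL-Probability.Probability"
begin

text \<open>The value of \<open>W_map\<close> outside the unit interval is irrelevant: all measures below
  live on \<open>{0..1}\<close>.\<close>

definition W_map :: "real \<Rightarrow> real \<Rightarrow> real \<Rightarrow> real \<Rightarrow> real \<Rightarrow> real \<Rightarrow> real \<Rightarrow> real" where
  "W_map s1 s2 p q r a x =
    (if x < 1/2 - (1/2 + r * a) / (s1 + p * a)
       then 1 - 2 * (s1 + p * a) / (s1 - 1 + p * a - 2 * r * a) * x
     else if x < 1/2
       then (s1 + p * a) * (x - 1/2) + 1/2 + r * a
     else if x < 1/2 + (1/2 + r * a) / (s2 + q * a)
       then - (s2 + q * a) * (x - 1/2) + 1/2 + r * a
     else 1 + 2 * (s2 + q * a) / (s2 - 1 + q * a - 2 * r * a) * (x - 1))"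

definition unit_lborel :: "real measure" where
  "unit_lborel = restrict_space lborel {0..1}"

text \<open>Absolutely continuous invariant probability measures on \<open>{0..1}\<close>. As
  \<open>space \<mu> = {0..1}\<close>, the measurability condition includes that \<open>T\<close> maps \<open>{0..1}\<close> into itself.\<close>

definition acim :: "(real \<Rightarrow> real) \<Rightarrow> real measure \<Rightarrow> bool" where
  "acim T \<mu> \<longleftrightarrow>
     prob_space \<mu> \<and> sets \<mu> = sets unit_lborel \<and> absolutely_continuous unit_lborel \<mu> \<and>
     T \<in> measurable \<mu> \<mu> \<and> distr \<mu> \<mu> T = \<mu>"

text \<open>The description is proper whenever \<open>W_map s1 s2 p q r a\<close> maps \<open>{0..1}\<close> into itself and has
  exactly one such measure; under the assumptions \<open>s1, s2 > 1\<close>, \<open>1/s1 + 1/s2 < 1\<close> and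
  \<open>p, q, r > 0\<close> this holds for \<open>a = 0\<close> and for all sufficiently small \<open>a > 0\<close>.\<close>

definition W_measure :: "real \<Rightarrow> real \<Rightarrow> real \<Rightarrow> real \<Rightarrow> real \<Rightarrow> real \<Rightarrow> real measure" where
  "W_measure s1 s2 p q r a = (THE \<mu>. acim (W_map s1 s2 p q r a) \<mu>)"

definition W_density :: "real \<Rightarrow> real \<Rightarrow> real \<Rightarrow> real \<Rightarrow> real \<Rightarrow> real \<Rightarrow> real \<Rightarrow> ennreal" where
  "W_density s1 s2 p q r a = RN_deriv unit_lborel (W_measure s1 s2 p q r a)"

end

theory Submission
  imports Defs
begin

text \<open>For small \<open>a\<close> the four branches of \<open>W_map s1 s2 p q r a\<close> are affine; the outer two map onto the unit interval, and
the inner two form a tent over \<open>1/2\<close> whose peak is close to \<open>1/2\<close>. The proof controls the transfer operator \<open>P\<close> on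
densities of bounded variation, with constants that do not depend on \<open>a\<close>.

The decisive estimate is \<open>lasota_yorke\<close>: one application of \<open>P\<close> turns the variation \<open>V\<close> of a density into at most
\<open>\<eta> * V + \<eta> / \<delta>\<close> with \<open>\<eta> < 1\<close>. Its only delicate part is the jump that the fold at \<open>1/2\<close> creates; sharing the
jump between the two adjacent pieces in the right proportion gives as factor the sum of the inverse middle
slopes, which is at most \<open>1/s1 + 1/s2 < 1\<close>. Consequently there is one constant \<open>K\<close> such that all \<open>P ^^ n\<close> map the
class of densities of variation at most \<open>K\<close> into itself, and its members are bounded by \<open>1 + K\<close>.

The same condition on the slopes makes intervals grow under the map until they cover everything
(\<open>locally_eventually_onto\<close>). A density in the class is at least \<open>1/2\<close> on one of finitely many intervals, so some
\<open>P ^^ n\<close> raises all of them above a common constant (\<open>uniform_minorization\<close>). Subtracting this constant repeatedly shows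
that \<open>P ^^ n\<close> contracts the class to a single density in the supremum norm (\<open>P_pow_uniform_limit\<close>). This density is
invariant and bounded by \<open>1 + K\<close>, and because it attracts all integrable functions in the weak sense
(\<open>mixes_integrable\<close>) it belongs to the only absolutely continuous invariant probability measure.

For the weak convergence, an invariant density for small \<open>a\<close> is a limit of members of the class, so a fixed high
iterate of the transfer operator for \<open>a = 0\<close> brings it close to the invariant density for \<open>a = 0\<close>. On the other hand this
iterate hardly differs, in the weak sense, from the corresponding iterate for \<open>a\<close>, which fixes the density
(\<open>invariant_density_stable\<close>).\<close>

section \<open>Integration over the unit interval\<close>

lemma space_unit [simp]: "space unit_lborel = {0..1}"
  by (simp add: unit_lborel_def space_restrict_space)

lemma measurable_unit: "f \<in> borel_measurable borel \<Longrightarrow> f \<in> borel_measurable unit_lborel"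
  for f :: "real \<Rightarrow> real"
  unfolding unit_lborel_def by (rule measurable_restrict_space1) simp

lemma prob_space_unit: "prob_space unit_lborel"
  unfolding unit_lborel_def
  by (rule prob_spaceI) (simp add: space_restrict_space emeasure_restrict_space)

interpretation unit: prob_space unit_lborel
  by (rule prob_space_unit)

lemma integrable_unit_bounded:
  fixes f :: "real \<Rightarrow> real"
  assumes "f \<in> borel_measurable borel" and "\<And>x. x \<in> {0..1} \<Longrightarrow> \<bar>f x\<bar> \<le> C"
  shows "integrable unit_lborel f"
  by (rule unit.integrable_const_bound[where B = C])
    (use assms in \<open>auto intro!: AE_I2 measurable_unit\<close>)

lemma integral_unit_eq:
  "(\<integral>x. f x \<partial>unit_lborel) = (\<integral>x. indicator {0..1} x * f x \<partial>lborel)" for f :: "real \<Rightarrow> real"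
  unfolding unit_lborel_def by (subst integral_restrict_space) auto

lemma integral_unit_mono:
  fixes f g :: "real \<Rightarrow> real"
  assumes "integrable unit_lborel f" "integrable unit_lborel g"
    and "\<And>x. x \<in> {0..1} \<Longrightarrow> f x \<le> g x"
  shows "(\<integral>x. f x \<partial>unit_lborel) \<le> (\<integral>x. g x \<partial>unit_lborel)"
  using assms by (intro integral_mono_AE AE_I2) auto

lemma measure_unit_interval:
  assumes "0 \<le> c" "c \<le> d" "d \<le> (1::real)"
  shows "measure unit_lborel {c..d} = d - c"
  unfolding unit_lborel_def using assms by (subst measure_restrict_space) auto

lemma dominated_unit:
  fixes s :: "nat \<Rightarrow> real \<Rightarrow> real"
  assumes "\<And>n. s n \<in> borel_measurable borel" "f \<in> borel_measurable borel"
    and "\<And>x. x \<in> {0..1} \<Longrightarrow> (\<lambda>n. s n x) \<longlonglongrightarrow> f x"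
    and "\<And>n x. x \<in> {0..1} \<Longrightarrow> \<bar>s n x\<bar> \<le> C"
  shows "(\<lambda>n. \<integral>x. s n x \<partial>unit_lborel) \<longlonglongrightarrow> (\<integral>x. f x \<partial>unit_lborel)"
  by (rule integral_dominated_convergence[where w = "\<lambda>_. C"])
    (use assms in \<open>auto intro!: AE_I2 measurable_unit\<close>)

section \<open>W-shaped maps and their transfer operator\<close>

text \<open>The map is parametrised by the data of its inverse branches: \<open>l\<close> and \<open>m\<close> are the widths of the
two outer branches (which are onto, so these are also their inverse slopes), \<open>A\<close> and \<open>B\<close> are the
inverse slopes of the two branches that meet at \<open>1/2\<close>, and \<open>t\<close> is the height of the peak there.
On the unit interval the left outer branch is positive to the left of the tent in the middle, the
right one to its right, and where one of the three is positive the others are at most 0. So the map is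
the maximum of the three; in this form it is visibly continuous, also jointly in the parameters.\<close>

definition wmap :: "real \<Rightarrow> real \<Rightarrow> real \<Rightarrow> real \<Rightarrow> real \<Rightarrow> real \<Rightarrow> real" where
  "wmap A B l m t x =
     max (max (1 - x / l) (1 - (1 - x) / m)) (t - max ((1/2 - x) / A) ((x - 1/2) / B))"

text \<open>The Perron-Frobenius operator, as a pointwise defined function. Both middle branches contribute
their value at \<open>1/2\<close> when \<open>y = t\<close>, so that the lower bound \<open>P_pow_along_orbit\<close> below holds at every
point and not just almost everywhere.\<close>

definition transfer :: "real \<Rightarrow> real \<Rightarrow> real \<Rightarrow> real \<Rightarrow> real \<Rightarrow> (real \<Rightarrow> real) \<Rightarrow> real \<Rightarrow> real" where
  "transfer A B l m t f y =
     l * f (l * (1 - y)) + m * f (1 - m * (1 - y)) +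
     (if y \<le> t then A * f (1/2 - A * (t - y)) + B * f (1/2 + B * (t - y)) else 0)"

text \<open>Probability densities of variation at most \<open>V\<close>. The variation is certified by a function \<open>u\<close> that
dominates all increments (for instance the variation function itself), which avoids
suprema over partitions: a certificate for the image under the transfer operator can be written
down from one for \<open>f\<close>.\<close>

definition bv_density :: "real \<Rightarrow> (real \<Rightarrow> real) \<Rightarrow> bool" where
  "bv_density V f \<longleftrightarrow>
     f \<in> borel_measurable borel \<and> (\<forall>x\<in>{0..1}. 0 \<le> f x) \<and> (\<integral>x. f x \<partial>unit_lborel) = 1 \<and>
     (\<exists>u. u 1 - u 0 \<le> V \<and> (\<forall>x y. 0 \<le> x \<and> x \<le> y \<and> y \<le> 1 \<longrightarrow> \<bar>f y - f x\<bar> \<le> u y - u x))"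

text \<open>The numbers \<open>\<eta>\<close> and \<open>\<delta>\<close> are not part of the map. They are the only quantities that enter the
bound on the variation, so maps that share them can be treated in the same class of densities.\<close>

locale w_shape =
  fixes A B l m t \<eta> \<delta> :: real
  assumes A0: "0 < A" and B0: "0 < B" and l0: "0 < l" and m0: "0 < m" and d0: "0 < \<delta>"
    and t_half: "1/2 \<le> t" and t1: "t < 1"
    and lA: "l + A * t = 1/2" and mB: "m + B * t = 1/2"
    and AB: "A + B \<le> \<eta>" and eta_half: "1/2 \<le> \<eta>" and eta1: "\<eta> < 1"
    and dA: "\<delta> \<le> A * t" and dB: "\<delta> \<le> B * t"
begin

abbreviation T where "T \<equiv> wmap A B l m t"
abbreviation P where "P \<equiv> transfer A B l m t"

lemma l_half: "l < 1/2" and m_half: "m < 1/2"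
proof -
  have "0 < A * t" "0 < B * t" using A0 B0 t_half by simp_all
  then show "l < 1/2" "m < 1/2" using lA mB by linarith+
qed

lemma T_left:
  assumes "0 \<le> x" "x \<le> l" shows "T x = 1 - x / l"
proof -
  have "x / l \<le> 1" using assms l0 by simp
  moreover have "m \<le> 1 - x" using assms l_half m_half by linarith
  hence "1 \<le> (1 - x) / m" using m0 by simp
  moreover have "A * t \<le> 1/2 - x" using lA assms by linarith
  hence "t \<le> (1/2 - x) / A" using A0 by (simp add: field_simps)
  ultimately show ?thesis unfolding wmap_def by linarith
qed

lemma T_midleft:
  assumes "l \<le> x" "x \<le> 1/2" shows "T x = t - (1/2 - x) / A"
proof -
  have "1 \<le> x / l" using assms l0 by simp
  moreover have "m \<le> 1 - x" using assms m_half by linarith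
  hence "1 \<le> (1 - x) / m" using m0 by simp
  moreover have "1/2 - x \<le> A * t" using lA assms by linarith
  hence "(1/2 - x) / A \<le> t" using A0 by (simp add: field_simps)
  moreover have "(x - 1/2) / B \<le> 0" "0 \<le> (1/2 - x) / A"
    using assms A0 B0 by (auto intro: divide_nonpos_pos divide_nonneg_pos)
  ultimately show ?thesis unfolding wmap_def by linarith
qed

lemma T_midright:
  assumes "1/2 \<le> x" "x \<le> 1 - m" shows "T x = t - (x - 1/2) / B"
proof -
  have "1 \<le> x / l" using assms l0 l_half by simp
  moreover have "m \<le> 1 - x" using assms m_half by linarith
  hence "1 \<le> (1 - x) / m" using m0 by simp
  moreover have "x - 1/2 \<le> B * t" using mB assms by linarith
  hence "(x - 1/2) / B \<le> t" using B0 by (simp add: field_simps)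
  moreover have "(1/2 - x) / A \<le> 0" "0 \<le> (x - 1/2) / B"
    using assms A0 B0 by (auto intro: divide_nonpos_pos divide_nonneg_pos)
  ultimately show ?thesis unfolding wmap_def by linarith
qed

lemma T_right:
  assumes "1 - m \<le> x" "x \<le> 1" shows "T x = 1 - (1 - x) / m"
proof -
  have "(1 - x) / m \<le> 1" using assms m0 by simp
  moreover have "l \<le> x" using assms l_half m_half by linarith
  hence "1 \<le> x / l" using l0 by simp
  moreover have "B * t \<le> x - 1/2" using mB assms by linarith
  hence "t \<le> (x - 1/2) / B" using B0 by (simp add: field_simps)
  ultimately show ?thesis unfolding wmap_def by linarith
qed

lemma T_unit:
  assumes "x \<in> {0..1}" shows "T x \<in> {0..1}"
proof -
  have pos: "0 \<le> T x"
  proof -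
    consider "0 \<le> x \<and> x \<le> l" | "l \<le> x \<and> x \<le> 1/2" | "1/2 \<le> x \<and> x \<le> 1 - m" | "1 - m \<le> x \<and> x \<le> 1"
      using assms by fastforce
    then show ?thesis
    proof cases
      case 1 then show ?thesis using T_left l0 by simp
    next
      case 2
      then have "(1/2 - x) / A \<le> t" using lA A0 by (simp add: field_simps)
      then show ?thesis using T_midleft 2 by simp
    next
      case 3
      then have "(x - 1/2) / B \<le> t" using mB B0 by (simp add: field_simps)
      then show ?thesis using T_midright 3 by simp
    next
      case 4 then show ?thesis using T_right m0 by simp
    qed
  qed
  have "0 \<le> max ((1/2 - x) / A) ((x - 1/2) / B)"
  proof (cases "x \<le> 1/2")
    case True
    then have "0 \<le> (1/2 - x) / A" using A0 by simp
    then show ?thesis by linarith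
  next
    case False
    then have "0 \<le> (x - 1/2) / B" using B0 by simp
    then show ?thesis by linarith
  qed
  moreover have "1 - x / l \<le> 1" "1 - (1 - x) / m \<le> 1" using assms l0 m0 by auto
  ultimately have "T x \<le> 1" unfolding wmap_def using t1 by simp
  with pos show ?thesis by simp
qed

lemma T_pow_unit: "x \<in> {0..1} \<Longrightarrow> (T ^^ n) x \<in> {0..1}"
  by (induction n) (use T_unit in auto)

lemma continuous_T: "continuous_on S T"
  unfolding wmap_def using A0 B0 l0 m0
  by (intro continuous_intros) auto

lemma T_measurable [measurable]: "T \<in> borel_measurable borel"
  using continuous_T[of UNIV] by (rule borel_measurable_continuous_onI)

lemma T_pow_measurable [measurable]: "(T ^^ n) \<in> borel_measurable borel"
  by (induction n) (auto simp: o_def)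

lemma P_measurable:
  assumes [measurable]: "f \<in> borel_measurable borel" shows "P f \<in> borel_measurable borel"
  unfolding transfer_def by measurable

lemma psi_unit:
  assumes "y \<in> {0..1}"
  shows "0 \<le> l * (1 - y)" "l * (1 - y) \<le> l" "1 - m \<le> 1 - m * (1 - y)" "1 - m * (1 - y) \<le> 1"
    "y \<le> t \<Longrightarrow> l \<le> 1/2 - A * (t - y)" "y \<le> t \<Longrightarrow> 1/2 - A * (t - y) \<le> 1/2"
    "y \<le> t \<Longrightarrow> 1/2 \<le> 1/2 + B * (t - y)" "y \<le> t \<Longrightarrow> 1/2 + B * (t - y) \<le> 1 - m"
proof -
  have *: "0 \<le> l * (1 - y)" "0 \<le> m * (1 - y)" "0 \<le> l * y" "0 \<le> m * y" "0 \<le> A * y" "0 \<le> B * y"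
    using assms A0 B0 l0 m0 by simp_all
  have **: "0 \<le> A * (t - y)" "0 \<le> B * (t - y)" if "y \<le> t"
    using that A0 B0 by simp_all
  note e = right_diff_distrib
  show "0 \<le> l * (1 - y)" "1 - m * (1 - y) \<le> 1" using * by simp_all
  show "l * (1 - y) \<le> l" using * unfolding e by linarith
  show "1 - m \<le> 1 - m * (1 - y)" using * unfolding e by linarith
  show "l \<le> 1/2 - A * (t - y)" if "y \<le> t" using * lA unfolding e by linarith
  show "1/2 + B * (t - y) \<le> 1 - m" if "y \<le> t" using * mB unfolding e by linarith
  show "1/2 - A * (t - y) \<le> 1/2" "1/2 \<le> 1/2 + B * (t - y)" if "y \<le> t" using ** that by simp_all
qed

end

lemma integrable_lborel_indicator:
  fixes g :: "real \<Rightarrow> real"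
  assumes [measurable]: "g \<in> borel_measurable borel" "S \<in> sets borel"
    and S: "S \<subseteq> {0..1}" and C: "\<And>x. x \<in> {0..1} \<Longrightarrow> \<bar>g x\<bar> \<le> C"
  shows "integrable lborel (\<lambda>x. indicator S x * g x)"
proof (rule Bochner_Integration.integrable_bound[where f = "\<lambda>x. indicator {0..1::real} x * C"])
  show "AE x in lborel. norm (indicator S x * g x) \<le> norm (indicator {0..1} x * C)"
    using S C by (intro AE_I2) (auto simp: indicator_def abs_mult intro!: order_trans[OF C abs_ge_self])
qed auto

lemma affine_substitution:
  fixes g F :: "real \<Rightarrow> real"
  assumes "integrable lborel g" "c \<noteq> 0" and F: "\<And>y. \<bar>c\<bar> * g (s + c * y) = F y"
  shows "integrable lborel F \<and> (\<integral>x. g x \<partial>lborel) = (\<integral>y. F y \<partial>lborel)"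
proof
  have F': "F = (\<lambda>y. \<bar>c\<bar> * g (s + c * y))" using F by auto
  show "integrable lborel F"
    unfolding F' using lborel_integrable_real_affine[OF assms(1,2)] by simp
  show "(\<integral>x. g x \<partial>lborel) = (\<integral>y. F y \<partial>lborel)"
    unfolding F' using lborel_integral_real_affine[OF assms(2), of g s] by simp
qed

context w_shape
begin

lemma T_psi:
  assumes "y \<in> {0..1}"
  shows "T (l * (1 - y)) = y" "T (1 - m * (1 - y)) = y"
    "y \<le> t \<Longrightarrow> T (1/2 - A * (t - y)) = y" "y \<le> t \<Longrightarrow> T (1/2 + B * (t - y)) = y"
proof -
  note psi = psi_unit[OF assms]
  show "T (l * (1 - y)) = y" using T_left[of "l * (1 - y)"] psi l0 by simp
  show "T (1 - m * (1 - y)) = y" using T_right[of "1 - m * (1 - y)"] psi m0 by simp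
  show "T (1/2 - A * (t - y)) = y" if "y \<le> t"
    using T_midleft[of "1/2 - A * (t - y)"] psi that A0 by simp
  show "T (1/2 + B * (t - y)) = y" if "y \<le> t"
    using T_midright[of "1/2 + B * (t - y)"] psi that B0 by simp
qed

text \<open>Change of variables on each of the four pieces. The endpoints, where pieces overlap or the
transfer operator jumps, form a null set.\<close>

lemma duality:
  fixes f \<phi> :: "real \<Rightarrow> real"
  assumes [measurable]: "f \<in> borel_measurable borel" "\<phi> \<in> borel_measurable borel"
    and f: "\<And>x. x \<in> {0..1} \<Longrightarrow> \<bar>f x\<bar> \<le> C" and \<phi>: "\<And>x. x \<in> {0..1} \<Longrightarrow> \<bar>\<phi> x\<bar> \<le> D"
  shows "(\<integral>x. \<phi> (T x) * f x \<partial>unit_lborel) = (\<integral>y. \<phi> y * P f y \<partial>unit_lborel)"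
proof -
  define G where "G = (\<lambda>x. \<phi> (T x) * f x)"
  have [measurable]: "G \<in> borel_measurable borel" unfolding G_def by measurable
  have "\<bar>G x\<bar> \<le> D * C" if "x \<in> {0..1}" for x
  proof -
    have "\<bar>\<phi> (T x)\<bar> \<le> D" "\<bar>f x\<bar> \<le> C" using \<phi>[OF T_unit[OF that]] f[OF that] by auto
    then show ?thesis unfolding G_def abs_mult by (intro mult_mono) auto
  qed
  note int = integrable_lborel_indicator[OF _ _ _ this]
  define F1 F2 F3 F4 where
    "F1 = (\<lambda>y. indicator {0<..<1} y * (\<phi> y * (l * f (l * (1 - y)))))"
    and "F2 = (\<lambda>y. indicator {0<..<t} y * (\<phi> y * (A * f (1/2 - A * (t - y)))))"
    and "F3 = (\<lambda>y. indicator {0<..<t} y * (\<phi> y * (B * f (1/2 + B * (t - y)))))"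
    and "F4 = (\<lambda>y. indicator {0<..<1} y * (\<phi> y * (m * f (1 - m * (1 - y)))))"
  have 1: "integrable lborel F1 \<and> (\<integral>x. indicator {0<..<l} x * G x \<partial>lborel) = (\<integral>y. F1 y \<partial>lborel)"
  proof (rule affine_substitution[where c = "-l" and s = l])
    show "integrable lborel (\<lambda>x. indicator {0<..<l} x * G x)"
      using l_half by (intro int) auto
    show "\<bar>-l\<bar> * (indicator {0<..<l} (l + (-l) * y) * G (l + (-l) * y)) = F1 y" for y
    proof -
      have "l + (-l) * y = l * (1 - y)" by (simp add: algebra_simps)
      moreover have "l * (1 - y) \<in> {0<..<l} \<longleftrightarrow> y \<in> {0<..<1}"
        using l0 by (auto simp: zero_less_mult_iff mult_less_cancel_left1)
      ultimately show ?thesis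
        using T_psi[of y] l0 unfolding F1_def G_def by (auto simp: indicator_def)
    qed
  qed (use l0 in auto)
  have 4: "integrable lborel F4 \<and> (\<integral>x. indicator {1-m<..<1} x * G x \<partial>lborel) = (\<integral>y. F4 y \<partial>lborel)"
  proof (rule affine_substitution[where c = m and s = "1 - m"])
    show "integrable lborel (\<lambda>x. indicator {1-m<..<1} x * G x)"
      using m_half by (intro int) auto
    show "\<bar>m\<bar> * (indicator {1-m<..<1} (1 - m + m * y) * G (1 - m + m * y)) = F4 y" for y
    proof -
      have *: "1 - m + m * y = 1 - m * (1 - y)" by (simp add: algebra_simps)
      have "1 - m + m * y \<in> {1-m<..<1} \<longleftrightarrow> y \<in> {0<..<1}"
        using m0 by (auto simp: zero_less_mult_iff mult_less_cancel_left1)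
      then show ?thesis
        using T_psi[of y] m0 unfolding F4_def G_def * by (auto simp: indicator_def)
    qed
  qed (use m0 in auto)
  have 2: "integrable lborel F2 \<and> (\<integral>x. indicator {l<..<1/2} x * G x \<partial>lborel) = (\<integral>y. F2 y \<partial>lborel)"
  proof (rule affine_substitution[where c = A and s = l])
    show "integrable lborel (\<lambda>x. indicator {l<..<1/2} x * G x)"
      using l0 by (intro int) auto
    show "\<bar>A\<bar> * (indicator {l<..<1/2} (l + A * y) * G (l + A * y)) = F2 y" for y
    proof -
      have *: "l + A * y = 1/2 - A * (t - y)" using lA by (simp add: algebra_simps)
      have "1/2 - A * (t - y) < 1/2 \<longleftrightarrow> y < t" using A0 by (simp add: zero_less_mult_iff)
      moreover have "l < l + A * y \<longleftrightarrow> 0 < y" using A0 by (simp add: zero_less_mult_iff)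
      ultimately have "1/2 - A * (t - y) \<in> {l<..<1/2} \<longleftrightarrow> y \<in> {0<..<t}"
        unfolding * by auto
      then show ?thesis
        using T_psi[of y] t1 A0 unfolding F2_def G_def * by (auto simp: indicator_def)
    qed
  qed (use A0 in auto)
  have 3: "integrable lborel F3 \<and> (\<integral>x. indicator {1/2<..<1-m} x * G x \<partial>lborel) = (\<integral>y. F3 y \<partial>lborel)"
  proof (rule affine_substitution[where c = "-B" and s = "1 - m"])
    show "integrable lborel (\<lambda>x. indicator {1/2<..<1-m} x * G x)"
      using m0 by (intro int) auto
    show "\<bar>-B\<bar> * (indicator {1/2<..<1-m} (1 - m + (-B) * y) * G (1 - m + (-B) * y)) = F3 y" for y
    proof -
      have *: "1 - m + (-B) * y = 1/2 + B * (t - y)" using mB by (simp add: algebra_simps)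
      have "1/2 < 1/2 + B * (t - y) \<longleftrightarrow> y < t" using B0 by (simp add: zero_less_mult_iff)
      moreover have "1 - m + (-B) * y < 1 - m \<longleftrightarrow> 0 < y" using B0 by (simp add: zero_less_mult_iff)
      ultimately have "1/2 + B * (t - y) \<in> {1/2<..<1-m} \<longleftrightarrow> y \<in> {0<..<t}"
        unfolding * by auto
      then show ?thesis
        using T_psi[of y] t1 B0 unfolding F3_def G_def * by (auto simp: indicator_def)
    qed
  qed (use B0 in auto)
  have "(\<integral>x. \<phi> (T x) * f x \<partial>unit_lborel) = (\<integral>x. indicator {0..1} x * G x \<partial>lborel)"
    unfolding integral_unit_eq G_def ..
  also have "\<dots> = (\<integral>x. indicator {0<..<l} x * G x + indicator {l<..<1/2} x * G x
      + (indicator {1/2<..<1-m} x * G x + indicator {1-m<..<1} x * G x) \<partial>lborel)"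
  proof (rule integral_cong_AE)
    have "AE x in lborel. x \<noteq> 0 \<and> x \<noteq> l \<and> x \<noteq> 1/2 \<and> x \<noteq> 1 - m \<and> x \<noteq> 1"
      by (intro AE_conjI AE_lborel_singleton)
    then show "AE x in lborel. indicator {0..1} x * G x = indicator {0<..<l} x * G x
        + indicator {l<..<1/2} x * G x
        + (indicator {1/2<..<1-m} x * G x + indicator {1-m<..<1} x * G x)"
    proof eventually_elim
      case (elim x)
      consider "x < 0" | "0 < x" "x < l" | "l < x" "x < 1/2" | "1/2 < x" "x < 1-m" | "1-m < x" "x < 1" | "1 < x"
        using elim by linarith
      then show ?case
        using l0 m0 l_half m_half by cases (auto simp: indicator_def)
    qed
  qed auto
  also have "\<dots> = ((\<integral>x. indicator {0<..<l} x * G x \<partial>lborel) + (\<integral>x. indicator {l<..<1/2} x * G x \<partial>lborel))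
      + ((\<integral>x. indicator {1/2<..<1-m} x * G x \<partial>lborel) + (\<integral>x. indicator {1-m<..<1} x * G x \<partial>lborel))"
    using l0 m0 l_half m_half
    by (subst Bochner_Integration.integral_add Bochner_Integration.integrable_add,
        (intro Bochner_Integration.integrable_add int; force)+)+ (rule refl)
  also have "\<dots> = ((\<integral>y. F1 y \<partial>lborel) + (\<integral>y. F2 y \<partial>lborel)) + ((\<integral>y. F3 y \<partial>lborel) + (\<integral>y. F4 y \<partial>lborel))"
    using 1 2 3 4 by simp
  also have "\<dots> = (\<integral>y. (F1 y + F2 y) + (F3 y + F4 y) \<partial>lborel)"
    using 1 2 3 4 by simp
  also have "\<dots> = (\<integral>y. indicator {0..1} y * (\<phi> y * P f y) \<partial>lborel)"
  proof (rule integral_cong_AE)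
    have "AE x in lborel. x \<noteq> 0 \<and> x \<noteq> t \<and> x \<noteq> 1"
      by (intro AE_conjI AE_lborel_singleton)
    then show "AE y in lborel. (F1 y + F2 y) + (F3 y + F4 y) = indicator {0..1} y * (\<phi> y * P f y)"
    proof eventually_elim
      case (elim y)
      consider "y < 0" | "0 < y" "y < t" | "t < y" "y < 1" | "1 < y"
        using elim by linarith
      then show ?case
        using t_half t1 by cases (auto simp: F1_def F2_def F3_def F4_def transfer_def algebra_simps)
    qed
    show "(\<lambda>y. (F1 y + F2 y) + (F3 y + F4 y)) \<in> borel_measurable lborel"
      unfolding F1_def F2_def F3_def F4_def by measurable
    have [measurable]: "P f \<in> borel_measurable borel" by (rule P_measurable) simp
    show "(\<lambda>y. indicator {0..1} y * (\<phi> y * P f y)) \<in> borel_measurable lborel" by measurable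
  qed
  also have "\<dots> = (\<integral>y. \<phi> y * P f y \<partial>unit_lborel)" unfolding integral_unit_eq ..
  finally show ?thesis .
qed

end

section \<open>Lasota-Yorke inequality in one step\<close>

lemma bv_density_var:
  assumes "bv_density V f" "x \<in> {0..1}" "y \<in> {0..1}"
  shows "\<bar>f x - f y\<bar> \<le> V"
proof -
  from assms(1) obtain u where V: "u 1 - u 0 \<le> V"
    and u: "\<And>x y. 0 \<le> x \<Longrightarrow> x \<le> y \<Longrightarrow> y \<le> 1 \<Longrightarrow> \<bar>f y - f x\<bar> \<le> u y - u x"
    unfolding bv_density_def by blast
  have *: "\<bar>f b - f a\<bar> \<le> V" if "0 \<le> a" "a \<le> b" "b \<le> 1" for a b
    using u[of a b] u[of 0 a] u[of b 1] V that by linarith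
  show ?thesis using *[of x y] *[of y x] assms(2,3) by (cases "x \<le> y") (auto simp: abs_minus_commute)
qed

lemma bv_density_nonneg: "bv_density V f \<Longrightarrow> x \<in> {0..1} \<Longrightarrow> 0 \<le> f x"
  and bv_density_measurable: "bv_density V f \<Longrightarrow> f \<in> borel_measurable borel"
  and bv_density_integral: "bv_density V f \<Longrightarrow> (\<integral>x. f x \<partial>unit_lborel) = 1"
  by (auto simp: bv_density_def)

lemma bv_density_integrable:
  assumes "bv_density V f" shows "integrable unit_lborel f"
proof (rule integrable_unit_bounded)
  show "f \<in> borel_measurable borel" by (rule bv_density_measurable[OF assms])
  show "\<bar>f x\<bar> \<le> \<bar>f 0\<bar> + V" if "x \<in> {0..1}" for x
    using bv_density_var[OF assms that, of 0] by auto
qed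

text \<open>If the value at one point exceeded \<open>1 + V\<close>, the density would exceed 1 everywhere, against its mean 1.\<close>

lemma bv_density_le:
  assumes f: "bv_density V f" and x: "x \<in> {0..1}"
  shows "f x \<le> 1 + V"
proof -
  have "f x - V \<le> f y" if "y \<in> {0..1}" for y
    using bv_density_var[OF f x that] by linarith
  then have "(\<integral>y. f x - V \<partial>unit_lborel) \<le> (\<integral>y. f y \<partial>unit_lborel)"
    by (intro integral_unit_mono) (auto intro: bv_density_integrable[OF f])
  then show ?thesis using bv_density_integral[OF f] unit.prob_space by simp
qed

lemma bv_density_abs_le: "bv_density V f \<Longrightarrow> x \<in> {0..1} \<Longrightarrow> \<bar>f x\<bar> \<le> 1 + V"
  using bv_density_le bv_density_nonneg by fastforce

lemma bv_density_mono: "bv_density V f \<Longrightarrow> V \<le> V' \<Longrightarrow> bv_density V' f"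
  unfolding bv_density_def by (meson order_trans)

lemma transfer_linear:
  "transfer A B l m t (\<lambda>x. a * f x + b * g x) y = a * transfer A B l m t f y + b * transfer A B l m t g y"
  by (simp add: transfer_def algebra_simps)

lemma transfer_pow_linear:
  "((transfer A B l m t) ^^ n) (\<lambda>x. a * f x + b * g x) =
     (\<lambda>x. a * ((transfer A B l m t) ^^ n) f x + b * ((transfer A B l m t) ^^ n) g x)"
  by (induction n) (auto simp: transfer_linear)

context w_shape
begin

lemma psi_in_unit:
  assumes "y \<in> {0..1}"
  shows "l * (1 - y) \<in> {0..1}" "1 - m * (1 - y) \<in> {0..1}"
    "y \<le> t \<Longrightarrow> 1/2 - A * (t - y) \<in> {0..1}" "y \<le> t \<Longrightarrow> 1/2 + B * (t - y) \<in> {0..1}"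
  using psi_unit[OF assms] l0 m0 l_half m_half unfolding atLeastAtMost_iff by linarith+

lemma P_nonneg:
  assumes "\<And>x. x \<in> {0..1} \<Longrightarrow> 0 \<le> f x" "y \<in> {0..1}"
  shows "0 \<le> P f y"
  unfolding transfer_def using psi_in_unit[OF assms(2)] A0 B0 l0 m0
  by (simp add: assms(1))

lemma P_integral:
  assumes f: "bv_density V f" shows "(\<integral>x. P f x \<partial>unit_lborel) = 1"
  using duality[of f "\<lambda>_. 1" "1 + V" 1] bv_density_measurable[OF f] bv_density_abs_le[OF f]
    bv_density_integral[OF f] by simp

text \<open>A function of integral 1 cannot exceed \<open>1 / \<delta>\<close> on all of an interval of length \<open>\<delta>\<close>; this turns
control of the variation on such an interval into control of the value at one of its points.\<close>

lemma half_value_bound: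
  assumes f: "bv_density V f" and cd: "0 \<le> c" "c + \<delta> \<le> d" "d \<le> 1"
    and v: "\<And>x. c \<le> x \<Longrightarrow> x \<le> d \<Longrightarrow> z - v \<le> f x"
  shows "z \<le> v + 1 / \<delta>"
proof (cases "z \<le> v")
  case True then show ?thesis 
    using add_mono[of z v 0 "1 / \<delta>"] d0 by simp
next
  case False
  have i: "integrable unit_lborel (\<lambda>x. indicator {c..d} x * (z - v))"
    by (rule integrable_unit_bounded[where C = "\<bar>z - v\<bar>"]) (auto simp: indicator_def)
  have "(z - v) * \<delta> \<le> (z - v) * (d - c)" using False cd by (intro mult_left_mono) auto
  also have "\<dots> = measure unit_lborel {c..d} * (z - v)"
    using cd d0 by (subst measure_unit_interval) auto
  also have "\<dots> = (\<integral>x. indicator {c..d} x * (z - v) \<partial>unit_lborel)"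
  proof -
    have "max c 0 = c" "min d 1 = d" using cd by auto
    then show ?thesis by simp
  qed
  also have "\<dots> \<le> (\<integral>x. f x \<partial>unit_lborel)"
    using v bv_density_nonneg[OF f]
    by (intro integral_unit_mono i bv_density_integrable[OF f]) (auto simp: indicator_def)
  also have "\<dots> = 1" by (rule bv_density_integral[OF f])
  finally show ?thesis using d0 by (simp add: field_simps)
qed

text \<open>The variation of the image of \<open>f\<close> consists of the variations on the four pieces, each multiplied by
the inverse slope, and of the jump \<open>J = (A + B) * f (1/2)\<close> at the peak. Bounding \<open>f (1/2)\<close> by the variation
on one adjacent piece alone would give a factor like \<open>2 * A + B\<close>, which may exceed 1. Instead the share
\<open>B * f (1/2)\<close> of the jump is charged to the left piece, whose variation already counts \<open>A\<close> times, and
the share \<open>A * f (1/2)\<close> to the right piece, which already counts \<open>B\<close> times. Both pieces then carry the factor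
\<open>A + B\<close>. This is where the condition on the harmonic mean of the slopes enters.\<close>

lemma lasota_yorke:
  assumes f: "bv_density V f"
  shows "bv_density (\<eta> * V + \<eta> / \<delta>) (P f)"
proof -
  from f obtain u where V: "u 1 - u 0 \<le> V"
    and u: "\<And>x y. 0 \<le> x \<Longrightarrow> x \<le> y \<Longrightarrow> y \<le> 1 \<Longrightarrow> \<bar>f y - f x\<bar> \<le> u y - u x"
    unfolding bv_density_def by blast
  have mono: "u x \<le> u y" if "0 \<le> x" "x \<le> y" "y \<le> 1" for x y
    using u[OF that] by linarith
  \<comment> \<open>The function \<open>w\<close> certifies the variation of the image; it jumps by \<open>J\<close> above the peak.\<close>
  define J where "J = (A + B) * f (1/2)"
  define w where "w = (\<lambda>y. - (l * u (l * (1 - y))) + m * u (1 - m * (1 - y)) +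
     (if y \<le> t then A * u (1/2 - A * (t - y)) - B * u (1/2 + B * (t - y))
      else (A - B) * u (1/2) + J))"
  define X where "X = u l - u 0"
  define Y where "Y = u (1/2) - u l"
  define Z where "Z = u (1 - m) - u (1/2)"
  define U where "U = u 1 - u (1 - m)"
  have ge0: "0 \<le> X" "0 \<le> Y" "0 \<le> Z" "0 \<le> U" unfolding X_def Y_def Z_def U_def
    using mono[of 0 l] mono[of l "1/2"] mono[of "1/2" "1-m"] mono[of "1-m" 1] l0 m0 l_half m_half by auto
  have XYZU: "X + Y + Z + U \<le> V" unfolding X_def Y_def Z_def U_def using V by linarith
  have fY: "f (1/2) \<le> Y + 1/\<delta>"
  proof (rule half_value_bound[OF f, of l "1/2"])
    fix x assume "l \<le> x" "x \<le> 1/2"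
    then show "f (1/2) - Y \<le> f x"
      using u[of x "1/2"] mono[of l x] l0 unfolding Y_def by (simp add: abs_le_iff)
  qed (use l0 lA dA in auto)
  have fZ: "f (1/2) \<le> Z + 1/\<delta>"
  proof (rule half_value_bound[OF f, of "1/2" "1 - m"])
    fix x assume "1/2 \<le> x" "x \<le> 1 - m"
    then show "f (1/2) - Z \<le> f x"
      using u[of "1/2" x] mono[of x "1 - m"] m0 unfolding Z_def by (simp add: abs_le_iff)
  qed (use m0 mB dB in auto)
  \<comment> \<open>The crossed distribution of the jump over the two pieces.\<close>
  have J: "J \<le> B * Y + A * Z + \<eta> / \<delta>"
  proof -
    have "J = B * f (1/2) + A * f (1/2)" unfolding J_def by (simp add: algebra_simps)
    also have "\<dots> \<le> B * (Y + 1/\<delta>) + A * (Z + 1/\<delta>)"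
      using fY fZ A0 B0 by (intro add_mono mult_left_mono) auto
    also have "\<dots> = B * Y + A * Z + (A + B) * (1/\<delta>)" by (simp only: distrib_left distrib_right ac_simps)
    also have "\<dots> \<le> B * Y + A * Z + \<eta> * (1/\<delta>)"
      using AB d0 by (intro add_left_mono mult_right_mono) auto
    finally show ?thesis by simp
  qed
  have w_var: "w 1 - w 0 \<le> \<eta> * V + \<eta> / \<delta>"
  proof -
    have "1/2 - A * t = l" "1/2 + B * t = 1 - m" using lA mB by auto
    then have "w 0 = - (l * u l) + m * u (1 - m) + (A * u l - B * u (1 - m))"
      using t_half unfolding w_def by simp
    moreover have "w 1 = - (l * u 0) + m * u 1 + ((A - B) * u (1/2) + J)"
      using t1 unfolding w_def by simp
    ultimately have "w 1 - w 0 = l * X + m * U + A * Y + B * Z + J"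
      unfolding X_def Y_def Z_def U_def by (simp add: algebra_simps)
    also have "\<dots> \<le> l * X + m * U + (A + B) * Y + (A + B) * Z + \<eta> / \<delta>"
      using J by (simp add: algebra_simps)
    also have "\<dots> \<le> \<eta> * X + \<eta> * U + \<eta> * Y + \<eta> * Z + \<eta> / \<delta>"
      using AB l_half m_half eta_half ge0 by (intro add_mono mult_right_mono) auto
    also have "\<dots> = \<eta> * (X + Y + Z + U) + \<eta> / \<delta>" by (simp add: algebra_simps)
    also have "\<dots> \<le> \<eta> * V + \<eta> / \<delta>"
      using XYZU eta_half by (intro add_right_mono mult_left_mono) auto
    finally show ?thesis .
  qed
  have outer: "\<bar>l * f (l * (1 - y)) - l * f (l * (1 - x))\<bar> \<le> l * u (l * (1 - x)) - l * u (l * (1 - y))"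
    "\<bar>m * f (1 - m * (1 - y)) - m * f (1 - m * (1 - x))\<bar> \<le> m * u (1 - m * (1 - y)) - m * u (1 - m * (1 - x))"
    if "0 \<le> x" "x \<le> y" "y \<le> 1" for x y
  proof -
    have "\<bar>f (l * (1 - y)) - f (l * (1 - x))\<bar> \<le> u (l * (1 - x)) - u (l * (1 - y))"
      using u[of "l * (1 - y)" "l * (1 - x)"] psi_in_unit[of x] psi_in_unit[of y] that l0
      by (auto simp: abs_minus_commute)
    from mult_left_mono[OF this, of l] l0
    show "\<bar>l * f (l * (1 - y)) - l * f (l * (1 - x))\<bar> \<le> l * u (l * (1 - x)) - l * u (l * (1 - y))"
      by (simp add: abs_mult_pos' flip: right_diff_distrib)
    have "\<bar>f (1 - m * (1 - y)) - f (1 - m * (1 - x))\<bar> \<le> u (1 - m * (1 - y)) - u (1 - m * (1 - x))"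
      using u[of "1 - m * (1 - x)" "1 - m * (1 - y)"] psi_in_unit[of x] psi_in_unit[of y] that m0
      by auto
    from mult_left_mono[OF this, of m] m0
    show "\<bar>m * f (1 - m * (1 - y)) - m * f (1 - m * (1 - x))\<bar> \<le> m * u (1 - m * (1 - y)) - m * u (1 - m * (1 - x))"
      by (simp add: abs_mult_pos' flip: right_diff_distrib)
  qed
  have inner: "\<bar>A * f (1/2 - A * (t - y)) - A * f (1/2 - A * (t - x))\<bar>
        \<le> A * u (1/2 - A * (t - y)) - A * u (1/2 - A * (t - x))"
    "\<bar>B * f (1/2 + B * (t - y)) - B * f (1/2 + B * (t - x))\<bar>
        \<le> B * u (1/2 + B * (t - x)) - B * u (1/2 + B * (t - y))"
    if "0 \<le> x" "x \<le> y" "y \<le> t" for x y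
  proof -
    have "\<bar>f (1/2 - A * (t - y)) - f (1/2 - A * (t - x))\<bar> \<le> u (1/2 - A * (t - y)) - u (1/2 - A * (t - x))"
      using u[of "1/2 - A * (t - x)" "1/2 - A * (t - y)"] psi_in_unit[of x] psi_in_unit[of y] that t1 A0
      by auto
    from mult_left_mono[OF this, of A] A0
    show "\<bar>A * f (1/2 - A * (t - y)) - A * f (1/2 - A * (t - x))\<bar>
        \<le> A * u (1/2 - A * (t - y)) - A * u (1/2 - A * (t - x))"
      by (simp add: abs_mult_pos' flip: right_diff_distrib)
    have "\<bar>f (1/2 + B * (t - y)) - f (1/2 + B * (t - x))\<bar> \<le> u (1/2 + B * (t - x)) - u (1/2 + B * (t - y))"
      using u[of "1/2 + B * (t - y)" "1/2 + B * (t - x)"] psi_in_unit[of x] psi_in_unit[of y] that t1 B0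
      by (auto simp: abs_minus_commute)
    from mult_left_mono[OF this, of B] B0
    show "\<bar>B * f (1/2 + B * (t - y)) - B * f (1/2 + B * (t - x))\<bar>
        \<le> B * u (1/2 + B * (t - x)) - B * u (1/2 + B * (t - y))"
      by (simp add: abs_mult_pos' flip: right_diff_distrib)
  qed
  have w: "\<bar>P f y - P f x\<bar> \<le> w y - w x" if xy: "0 \<le> x" "x \<le> y" "y \<le> 1" for x y
  proof -
    consider "y \<le> t" | "x \<le> t" "t < y" | "t < x" by linarith
    then show ?thesis
    proof cases
      case 1
      then have "x \<le> t" using xy by simp
      then show ?thesis
        unfolding transfer_def w_def if_P[OF 1] if_P[OF \<open>x \<le> t\<close>]
        using outer[OF xy] inner[OF xy(1,2) 1] by linarith
    next
      case 2
      have "A * f (1/2 - A * (t - x)) \<le> A * (f (1/2) + (u (1/2) - u (1/2 - A * (t - x))))"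
        using inner(1)[of x t] 2 xy A0 by (simp add: algebra_simps)
      moreover have "B * f (1/2 + B * (t - x)) \<le> B * (f (1/2) + (u (1/2 + B * (t - x)) - u (1/2)))"
        using inner(2)[of x t] 2 xy B0 by (simp add: algebra_simps)
      moreover have "0 \<le> A * f (1/2 - A * (t - x))" "0 \<le> B * f (1/2 + B * (t - x))"
        using bv_density_nonneg[OF f] psi_in_unit[of x] xy 2 A0 B0 by auto
      ultimately show ?thesis
        using outer[OF xy] 2 unfolding transfer_def w_def J_def by (simp add: algebra_simps)
    next
      case 3
      then show ?thesis using outer[OF xy] xy unfolding transfer_def w_def by simp
    qed
  qed
  show ?thesis
    unfolding bv_density_def
    using P_measurable[OF bv_density_measurable[OF f]] P_nonneg bv_density_nonneg[OF f]
      P_integral[OF f] w w_var by blast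
qed

text \<open>Twice the fixed point of \<open>V \<mapsto> \<eta> * V + \<eta> / \<delta>\<close>. The slack makes densities of larger variation enter the
class \<open>bv_density K\<close> after finitely many steps.\<close>

definition K where "K = 2 * \<eta> / (\<delta> * (1 - \<eta>))"

lemma K_fixed: "\<eta> * (K / 2) + \<eta> / \<delta> = K / 2"
proof -
  have "K * (\<delta> * (1 - \<eta>)) = 2 * \<eta>" unfolding K_def using d0 eta1 by simp
  then show ?thesis using d0 by (simp add: field_simps)
qed

lemma K_ge_1: "1 \<le> K"
proof -
  have "\<delta> \<le> 1/2" using dA lA l0 by linarith
  then have "\<delta> * (1 - \<eta>) \<le> 1/2 * (1/2)" using eta_half eta1 d0 by (intro mult_mono) auto
  moreover have "0 < \<delta> * (1 - \<eta>)" using d0 eta1 by simp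
  ultimately show ?thesis unfolding K_def using eta_half by (simp add: field_simps)
qed

lemma lasota_yorke_pow:
  "bv_density (V + K/2) f \<Longrightarrow> bv_density (\<eta> ^ n * V + K/2) ((P ^^ n) f)"
proof (induction n)
  case (Suc n)
  have "\<eta> * (\<eta> ^ n * V + K/2) + \<eta> / \<delta> = \<eta> ^ Suc n * V + K/2"
    using K_fixed by (simp add: algebra_simps)
  with lasota_yorke[OF Suc.IH[OF Suc.prems]] show ?case by simp
qed simp

lemma bv_density_P_pow:
  assumes "bv_density K f" shows "bv_density K ((P ^^ n) f)"
proof -
  have "\<eta> ^ n * (K/2) \<le> 1 * (K/2)" 
    using K_ge_1 eta_half eta1 by (intro mult_right_mono power_le_one) auto
  then show ?thesis
    using lasota_yorke_pow[of "K/2" f n] assms by (auto intro: bv_density_mono)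
qed

lemma bv_density_contract: "\<exists>n. \<forall>f. bv_density (2 * K) f \<longrightarrow> bv_density K ((P ^^ n) f)"
proof -
  have "(\<lambda>n. \<eta> ^ n) \<longlonglongrightarrow> 0" using eta_half eta1 by (intro LIMSEQ_power_zero) auto
  then have "eventually (\<lambda>n. \<eta> ^ n < 1/3) sequentially" by (rule order_tendstoD) simp
  then obtain n where "\<eta> ^ n < 1/3" by (auto simp: eventually_sequentially)
  then have "\<eta> ^ n * (3/2 * K) + K/2 \<le> K"
    using mult_right_mono[of "\<eta> ^ n" "1/3" "3/2 * K"] K_ge_1 by linarith
  moreover have "3/2 * K + K/2 = 2 * K" by simp
  ultimately show ?thesis
    using lasota_yorke_pow[of "3/2 * K" _ n] by (metis bv_density_mono)
qed

lemma bv_density_one: "bv_density K (\<lambda>_. 1)"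
  using unit.prob_space K_ge_1 unfolding bv_density_def
  by (auto intro!: exI[of _ "\<lambda>_. 0"])

lemma duality_pow:
  fixes f \<phi> :: "real \<Rightarrow> real"
  assumes f: "bv_density K f" and \<phi>[measurable]: "\<phi> \<in> borel_measurable borel"
    and D: "\<And>x. x \<in> {0..1} \<Longrightarrow> \<bar>\<phi> x\<bar> \<le> D"
  shows "(\<integral>x. \<phi> ((T ^^ n) x) * f x \<partial>unit_lborel) = (\<integral>y. \<phi> y * (P ^^ n) f y \<partial>unit_lborel)"
  using f
proof (induction n arbitrary: f)
  case (Suc n)
  have "(\<integral>x. \<phi> ((T ^^ Suc n) x) * f x \<partial>unit_lborel) = (\<integral>x. \<phi> ((T ^^ n) (T x)) * f x \<partial>unit_lborel)"
    by (simp add: funpow_swap1)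
  also have "\<dots> = (\<integral>x. \<phi> ((T ^^ n) x) * P f x \<partial>unit_lborel)"
    using bv_density_measurable[OF Suc.prems] bv_density_abs_le[OF Suc.prems] D T_pow_unit
    by (intro duality[where C = "1 + K" and D = D]) (auto intro!: measurable_compose[OF T_pow_measurable \<phi>])
  also have "\<dots> = (\<integral>y. \<phi> y * (P ^^ n) (P f) y \<partial>unit_lborel)"
    using bv_density_P_pow[OF Suc.prems, of 1] by (intro Suc.IH) simp
  finally show ?case by (simp add: funpow_swap1)
qed simp

section \<open>Intervals spread over the whole unit interval\<close>

lemma T_image_Icc:
  assumes "x \<in> {c..d}" "y \<in> {c..d}" shows "{T x..T y} \<subseteq> T ` {c..d}"
  using connected_continuous_image[OF continuous_T, of "{c..d}"] assms
  by (intro connected_contains_Icc) auto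

lemma T_values: "T 0 = 1" "T l = 0" "T (1 - m) = 0" "T 1 = 1" "T (1/2) = t"
  using T_left[of 0] T_left[of l] T_right[of "1 - m"] T_right[of 1] T_midleft[of "1/2"] l0 m0 l_half m_half
  by auto

text \<open>An interval around \<open>1/2\<close> is folded, but its longer half survives: if both halves have images of length
at most \<open>L\<close>, then their total length is at most \<open>(A + B) * L\<close>.\<close>

lemma interval_grows:
  assumes cd: "0 \<le> c" "c < d" "d \<le> 1" and crit: "\<not> (c < l \<and> l < d)" "\<not> (c < 1 - m \<and> 1 - m < d)"
  shows "\<exists>c' d'. 0 \<le> c' \<and> d' \<le> 1 \<and> d - c \<le> \<eta> * (d' - c') \<and> {c'..d'} \<subseteq> T ` {c..d}"
proof -
  have *: ?thesis if "x \<in> {c..d}" "y \<in> {c..d}" "d - c \<le> \<eta> * (T y - T x)" for x y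
  proof -
    have "0 \<le> T x" "T y \<le> 1" using that cd T_unit[of x] T_unit[of y] by auto
    then show ?thesis using T_image_Icc[OF that(1,2)] that(3) by blast
  qed
  have scale: "d - c \<le> \<eta> * ((d - c) / b)" if "0 < b" "b \<le> \<eta>" for b
  proof -
    have "(d - c) * b \<le> (d - c) * \<eta>" using that cd by (intro mult_left_mono) auto
    then show ?thesis using that by (simp add: field_simps)
  qed
  consider "d \<le> l" | "l \<le> c" "d \<le> 1/2" | "l \<le> c" "c \<le> 1/2" "1/2 \<le> d" "d \<le> 1 - m"
    | "1/2 \<le> c" "d \<le> 1 - m" | "1 - m \<le> c"
    using crit cd l_half m_half by linarith
  then show ?thesis
  proof cases
    case 1
    have "T c - T d = (d - c) / l"
      using T_left[of c] T_left[of d] 1 cd by (simp add: diff_divide_distrib)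
    then show ?thesis using *[of d c] scale[of l] l0 l_half eta_half cd by auto
  next
    case 2
    have "T d - T c = (d - c) / A"
      using T_midleft[of c] T_midleft[of d] 2 cd by (simp add: diff_divide_distrib)
    then show ?thesis using *[of c d] scale[of A] A0 B0 AB cd by auto
  next
    case 3
    have TA: "1/2 - c = A * (T (1/2) - T c)" and TB: "d - 1/2 = B * (T (1/2) - T d)"
      using T_midleft[of c] T_midright[of d] T_values 3 A0 B0 by (auto simp: field_simps)
    have ge0: "0 \<le> T (1/2) - T c" "0 \<le> T (1/2) - T d"
      using T_midleft[of c] T_midright[of d] T_values 3 A0 B0 by auto
    show ?thesis
    proof (cases "T c \<le> T d")
      case True
      have "d - c \<le> A * (T (1/2) - T c) + B * (T (1/2) - T c)"
        using TA TB mult_left_mono[OF True, of B] B0 unfolding right_diff_distrib by linarith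
      also have "\<dots> = (A + B) * (T (1/2) - T c)" by (simp only: distrib_right)
      also have "\<dots> \<le> \<eta> * (T (1/2) - T c)"
        using AB ge0 by (intro mult_right_mono) auto
      finally show ?thesis using *[of c "1/2"] 3 by auto
    next
      case False
      then have True: "T d \<le> T c" by simp
      have "d - c \<le> A * (T (1/2) - T d) + B * (T (1/2) - T d)"
        using TA TB mult_left_mono[OF True, of A] A0 unfolding right_diff_distrib by linarith
      also have "\<dots> = (A + B) * (T (1/2) - T d)" by (simp only: distrib_right)
      also have "\<dots> \<le> \<eta> * (T (1/2) - T d)"
        using AB ge0 by (intro mult_right_mono) auto
      finally show ?thesis using *[of d "1/2"] 3 by auto
    qed
  next
    case 4
    have "T c - T d = (d - c) / B"
      using T_midright[of c] T_midright[of d] 4 cd by (simp add: diff_divide_distrib)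
    then show ?thesis using *[of d c] scale[of B] A0 B0 AB cd by auto
  next
    case 5
    have "T d - T c = (d - c) / m"
      using T_right[of c] T_right[of d] 5 cd by (simp add: diff_divide_distrib)
    then show ?thesis using *[of c d] scale[of m] m0 m_half eta_half cd by auto
  qed
qed

lemma T_pow_image_subset:
  assumes "{a..b} \<subseteq> (T ^^ n) ` S" "{c..d} \<subseteq> (T ^^ k) ` {a..b}"
  shows "{c..d} \<subseteq> (T ^^ (k + n)) ` S"
proof -
  have "{c..d} \<subseteq> (T ^^ k) ` ((T ^^ n) ` S)" using assms by (meson image_mono subset_trans)
  then show ?thesis by (simp add: funpow_add image_comp)
qed

text \<open>Growth at the rate \<open>1 / \<eta>\<close> cannot go on for ever inside the unit interval, so eventually an image
contains a preimage of 0 in its interior.\<close>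

lemma reaches_critical:
  assumes cd: "0 \<le> c" "c < d" "d \<le> 1"
  shows "\<exists>n c' d'. 0 \<le> c' \<and> d' \<le> 1 \<and> {c'..d'} \<subseteq> (T ^^ n) ` {c..d} \<and>
     (c' < l \<and> l < d' \<or> c' < 1 - m \<and> 1 - m < d')"
proof (rule ccontr)
  assume no: "\<not> ?thesis"
  have "\<exists>c' d'. 0 \<le> c' \<and> c' < d' \<and> d' \<le> 1 \<and> d - c \<le> \<eta> ^ n * (d' - c') \<and> {c'..d'} \<subseteq> (T ^^ n) ` {c..d}" for n
  proof (induction n)
    case 0 then show ?case using cd by auto
  next
    case (Suc n)
    then obtain c1 d1 where 1: "0 \<le> c1" "c1 < d1" "d1 \<le> 1" "d - c \<le> \<eta> ^ n * (d1 - c1)"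
      "{c1..d1} \<subseteq> (T ^^ n) ` {c..d}" by blast
    have "\<not> (c1 < l \<and> l < d1)" using no 1(1,3,5) by blast
    moreover have "\<not> (c1 < 1 - m \<and> 1 - m < d1)" using no 1(1,3,5) by blast
    ultimately have "\<not> (c1 < l \<and> l < d1)" "\<not> (c1 < 1 - m \<and> 1 - m < d1)" .
    from interval_grows[OF 1(1-3) this] obtain c2 d2 where
      2: "0 \<le> c2" "d2 \<le> 1" "d1 - c1 \<le> \<eta> * (d2 - c2)" "{c2..d2} \<subseteq> T ` {c1..d1}" by blast
    have "0 < \<eta> * (d2 - c2)" using 1 2 by linarith
    then have "c2 < d2" using eta_half by (simp add: zero_less_mult_iff)
    moreover have "d - c \<le> \<eta> ^ Suc n * (d2 - c2)"
    proof -
      have "\<eta> ^ n * (d1 - c1) \<le> \<eta> ^ n * (\<eta> * (d2 - c2))"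
        using 2(3) eta_half by (intro mult_left_mono) auto
      then show ?thesis using 1(4) by (simp add: mult_ac)
    qed
    moreover have "{c2..d2} \<subseteq> (T ^^ Suc n) ` {c..d}"
      using T_pow_image_subset[OF 1(5), of c2 d2 1] 2(4) by simp
    ultimately show ?case using 2 by blast
  qed
  note intervals = this
  have "d - c \<le> \<eta> ^ n" for n
  proof -
    obtain c' d' where *: "0 \<le> c'" "d' \<le> 1" "d - c \<le> \<eta> ^ n * (d' - c')" using intervals[of n] by blast
    have "\<eta> ^ n * (d' - c') \<le> \<eta> ^ n * 1" using * eta_half by (intro mult_left_mono) auto
    then show ?thesis using *(3) by simp
  qed
  moreover have "(\<lambda>n. \<eta> ^ n) \<longlonglongrightarrow> 0" using eta_half eta1 by (intro LIMSEQ_power_zero) auto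
  ultimately have "d - c \<le> 0" using LIMSEQ_le_const[of "\<lambda>n. \<eta> ^ n" 0 "d - c"] by blast
  then show False using cd by simp
qed

text \<open>The point 1 is a fixed point whose branch has slope greater than 2.\<close>

lemma near_one_covers:
  assumes "0 < e" "e \<le> 1"
  shows "\<exists>n. {0..1} \<subseteq> (T ^^ n) ` {1 - e..1}"
proof -
  have step: "{1 - min m (2 ^ n * e)..1} \<subseteq> (T ^^ n) ` {1 - e..1}" for n
  proof (induction n)
    case 0 then show ?case by auto
  next
    case (Suc n)
    define e' where "e' = min m (2 ^ n * e)"
    have e': "0 < e'" "e' \<le> m" unfolding e'_def using assms m0 by auto
    have "2 * e' \<le> e' / m" using e' m0 m_half by (simp add: field_simps)
    moreover have "min m (2 ^ Suc n * e) \<le> 2 * e'" unfolding e'_def using m0 by auto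
    moreover have "T (1 - e') = 1 - e' / m" using T_right[of "1 - e'"] e' m_half by simp
    ultimately have "{1 - min m (2 ^ Suc n * e)..1} \<subseteq> {T (1 - e')..T 1}"
      using T_values by auto
    also have "\<dots> \<subseteq> (T ^^ 1) ` {1 - e'..1}" using T_image_Icc[of "1 - e'" "1 - e'" 1 1] e' by simp
    finally show ?case using T_pow_image_subset[OF Suc[folded e'_def], of _ _ 1] by simp
  qed
  obtain n where "m / e < 2 ^ n" using real_arch_pow[of 2 "m / e"] by auto
  then have "min m (2 ^ n * e) = m" using assms by (simp add: field_simps)
  with step[of n] have "{1 - m..1} \<subseteq> (T ^^ n) ` {1 - e..1}" by simp
  moreover have "{0..1} \<subseteq> (T ^^ 1) ` {1 - m..1}"
    using T_image_Icc[of "1 - m" "1 - m" 1 1] T_values m0 by simp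
  ultimately show ?thesis using T_pow_image_subset by blast
qed

lemma near_zero_covers:
  assumes "0 < e" "e \<le> 1"
  shows "\<exists>n. {0..1} \<subseteq> (T ^^ n) ` {0..e}"
proof -
  define e' where "e' = min e l"
  have e': "0 < e'" "e' \<le> l" "e' \<le> e" unfolding e'_def using assms l0 by auto
  have "T e' = 1 - e' / l" using T_left[of e'] e' by simp
  then have "{1 - e' / l..1} \<subseteq> (T ^^ 1) ` {0..e}"
    using T_image_Icc[of e' 0 e 0] T_values e' by simp
  moreover have "0 < e' / l" "e' / l \<le> 1" using e' l0 by auto
  then obtain n where "{0..1} \<subseteq> (T ^^ n) ` {1 - e' / l..1}" using near_one_covers by blast
  ultimately show ?thesis using T_pow_image_subset by blast
qed

lemma locally_eventually_onto:
  assumes cd: "0 \<le> c" "c < d" "d \<le> 1"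
  shows "\<exists>n. {0..1} \<subseteq> (T ^^ n) ` {c..d}"
proof -
  from reaches_critical[OF cd] obtain n c' d' where
    n: "0 \<le> c'" "d' \<le> 1" "{c'..d'} \<subseteq> (T ^^ n) ` {c..d}"
    and crit: "c' < l \<and> l < d' \<or> c' < 1 - m \<and> 1 - m < d'" by blast
  have "\<exists>e. 0 < e \<and> e \<le> 1 \<and> {0..e} \<subseteq> T ` {c'..d'}"
  proof -
    from crit show ?thesis
    proof
      assume *: "c' < l \<and> l < d'"
      then have "T c' = 1 - c' / l" using T_left n by simp
      then have "0 < T c'" "T c' \<le> 1" using * n l0 by auto
      then show ?thesis using T_image_Icc[of l c' d' c'] T_values * by auto
    next
      assume *: "c' < 1 - m \<and> 1 - m < d'"
      then have "T d' = 1 - (1 - d') / m" using T_right n by simp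
      then have "0 < T d'" "T d' \<le> 1" using * n m0 by auto
      then show ?thesis using T_image_Icc[of "1 - m" c' d' d'] T_values * by auto
    qed
  qed
  then obtain e where e: "0 < e" "e \<le> 1" "{0..e} \<subseteq> T ` {c'..d'}" by blast
  have e1: "{0..e} \<subseteq> (T ^^ 1) ` {c'..d'}" using e(3) by simp
  obtain k where k: "{0..1} \<subseteq> (T ^^ k) ` {0..e}" using near_zero_covers[OF e(1,2)] by blast
  show ?thesis using T_pow_image_subset[OF n(3) T_pow_image_subset[OF e1 k]] by blast
qed

lemma locally_eventually_onto_later:
  assumes "{0..1} \<subseteq> (T ^^ n) ` S" shows "{0..1} \<subseteq> (T ^^ (k + n)) ` S"
proof (rule T_pow_image_subset[OF assms])
  show "{0..1} \<subseteq> (T ^^ k) ` {0..1}"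
  proof (induction k)
    case (Suc k)
    have "{0..1} \<subseteq> (T ^^ 1) ` {0..1}"
      using T_image_Icc[of l 0 1 0] T_values l0 l_half by simp
    then show ?case using T_pow_image_subset[OF Suc, of 0 1 1] by simp
  qed simp
qed

section \<open>Doeblin minorization and contraction\<close>

text \<open>The point \<open>x\<close> is one of the preimages over which the transfer operator sums.\<close>

lemma P_pow_along_orbit:
  assumes f: "\<And>x. x \<in> {0..1} \<Longrightarrow> 0 \<le> f x" and \<kappa>: "0 \<le> \<kappa>" "\<kappa> \<le> l" "\<kappa> \<le> m" "\<kappa> \<le> A" "\<kappa> \<le> B"
    and x: "x \<in> {0..1}"
  shows "\<kappa> ^ n * f x \<le> (P ^^ n) f ((T ^^ n) x)"
proof -
  have nonneg: "0 \<le> (P ^^ n) f y" if "y \<in> {0..1}" for y n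
    using that by (induction n arbitrary: y) (auto intro: f P_nonneg)
  have one: "\<kappa> * g z \<le> P g (T z)" if g: "\<And>x. x \<in> {0..1} \<Longrightarrow> 0 \<le> g x" and z: "z \<in> {0..1}" for g z
  proof -
    define y where "y = T z"
    have y: "y \<in> {0..1}" using T_unit[OF z] unfolding y_def .
    note psi = psi_in_unit[OF y]
    have terms: "0 \<le> l * g (l * (1 - y))" "0 \<le> m * g (1 - m * (1 - y))"
      "y \<le> t \<Longrightarrow> 0 \<le> A * g (1/2 - A * (t - y))" "y \<le> t \<Longrightarrow> 0 \<le> B * g (1/2 + B * (t - y))"
      using psi g l0 m0 A0 B0 by auto
    have k: "\<kappa> * g z \<le> b * g z" if "\<kappa> \<le> b" for b
      using that g[OF z] by (intro mult_right_mono)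
    consider "z \<le> l" | "l \<le> z" "z \<le> 1/2" | "1/2 \<le> z" "z \<le> 1 - m" | "1 - m \<le> z" by linarith
    then have "\<kappa> * g z \<le> P g y"
    proof cases
      case 1
      then have "z = l * (1 - y)" using T_left[of z] z l0 unfolding y_def by simp
      then show ?thesis using terms k[OF \<kappa>(2)] unfolding transfer_def by (cases "y \<le> t") simp_all
    next
      case 2
      then have "y = t - (1/2 - z) / A" using T_midleft[of z] unfolding y_def by simp
      moreover from this have "y \<le> t" using 2 A0 by simp
      ultimately have "z = 1/2 - A * (t - y)" "y \<le> t" using A0 by auto
      then show ?thesis using terms k[OF \<kappa>(4)] unfolding transfer_def by simp
    next
      case 3
      then have "y = t - (z - 1/2) / B" using T_midright[of z] unfolding y_def by simp
      moreover from this have "y \<le> t" using 3 B0 by simp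
      ultimately have "z = 1/2 + B * (t - y)" "y \<le> t" using B0 by auto
      then show ?thesis using terms k[OF \<kappa>(5)] unfolding transfer_def by simp
    next
      case 4
      then have "z = 1 - m * (1 - y)" using T_right[of z] z m0 unfolding y_def by simp
      then show ?thesis using terms k[OF \<kappa>(3)] unfolding transfer_def by (cases "y \<le> t") simp_all
    qed
    then show ?thesis unfolding y_def .
  qed
  show ?thesis
  proof (induction n)
    case (Suc n)
    have "\<kappa> ^ Suc n * f x \<le> \<kappa> * (P ^^ n) f ((T ^^ n) x)"
      using mult_left_mono[OF Suc \<kappa>(1)] by (simp add: mult.assoc)
    also have "\<dots> \<le> P ((P ^^ n) f) (T ((T ^^ n) x))"
      using nonneg T_pow_unit[OF x] by (intro one) auto
    finally show ?case by simp
  qed simp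
qed

text \<open>If \<open>f\<close> dropped below \<open>1/2\<close> somewhere in every cell of length \<open>1 / N\<close>, it would be at most \<open>1/2\<close> plus its
variation in the cell, and the integral of this bound is at most \<open>1/2 + V / N < 1\<close>. Only finitely many cells come
into question, whence the uniformity of the next lemma.\<close>

lemma bv_density_large_on_cell:
  assumes f: "bv_density V f" and N: "2 * V < real N" "0 < N"
  shows "\<exists>i<N. \<forall>x\<in>{real i / N..(real i + 1) / N}. 1/2 \<le> f x"
proof (rule ccontr)
  assume no: "\<not> ?thesis"
  have "\<forall>i\<in>{..<N}. \<exists>x. x \<in> {real i / N..(real i + 1) / N} \<and> f x < 1/2"
  proof
    fix i assume "i \<in> {..<N}"
    then have "\<not> (\<forall>x\<in>{real i / N..(real i + 1) / N}. 1/2 \<le> f x)" using no by blast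
    then show "\<exists>x. x \<in> {real i / N..(real i + 1) / N} \<and> f x < 1/2"
      unfolding Ball_def not_all not_imp not_le by blast
  qed
  from bchoice[OF this] obtain z where
    z: "i < N \<Longrightarrow> z i \<in> {real i / N..(real i + 1) / N} \<and> f (z i) < 1/2" for i
    unfolding Ball_def lessThan_iff by blast
  from f obtain u where V: "u 1 - u 0 \<le> V"
    and u: "\<And>x y. 0 \<le> x \<Longrightarrow> x \<le> y \<Longrightarrow> y \<le> 1 \<Longrightarrow> \<bar>f y - f x\<bar> \<le> u y - u x"
    unfolding bv_density_def by blast
  define I where "I = (\<lambda>i. {real i / N..(real i + 1) / N})"
  define h where "h = (\<lambda>i. 1/2 + (u (real (Suc i) / N) - u (real i / N)))"
  have I01: "0 \<le> real i / N" "real i / N \<le> (real i + 1) / N" "(real i + 1) / N \<le> 1" if "i < N" for i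
    using that N by (auto simp: divide_simps)
  have fh: "f x \<le> h i" if i: "i < N" and x: "x \<in> I i" for i x
  proof -
    define a b where "a = real i / N" and "b = (real i + 1) / N"
    have ab: "0 \<le> a" "a \<le> b" "b \<le> 1" and xz: "a \<le> x" "x \<le> b" "a \<le> z i" "z i \<le> b"
      using I01[OF i] z[OF i] x unfolding I_def a_def b_def by simp_all
    have mono: "u v \<le> u w" if "a \<le> v" "v \<le> w" "w \<le> b" for v w
      using u[of v w] ab that by linarith
    have "\<bar>f x - f (z i)\<bar> \<le> u b - u a"
    proof (cases "x \<le> z i")
      case True
      then show ?thesis using u[of x "z i"] mono[of a x] mono[of "z i" b] ab xz by linarith
    next
      case False
      then show ?thesis using u[of "z i" x] mono[of a "z i"] mono[of x b] ab xz by linarith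
    qed
    then have "\<bar>f x - f (z i)\<bar> \<le> u ((real i + 1) / N) - u (real i / N)"
      unfolding a_def b_def .
    moreover have "f (z i) < 1/2" using z[OF i] by blast
    ultimately show ?thesis unfolding h_def of_nat_Suc add.commute[of 1] by linarith
  qed
  have h0: "0 \<le> h i" if "i < N" for i
    using fh[OF that, of "real i / N"] bv_density_nonneg[OF f, of "real i / N"] I01[OF that] unfolding I_def by auto
  \<comment> \<open>The point 1 needs its own choice of cell, as the floor would give the index \<open>N\<close>.\<close>
  have cover: "f x \<le> (\<Sum>i<N. indicator (I i) x * h i)" if x: "x \<in> {0..1}" for x
  proof -
    define i where "i = (if x = 1 then N - 1 else nat \<lfloor>x * N\<rfloor>)"
    have i: "i < N" "x \<in> I i"
    proof -
      have "i < N \<and> x \<in> I i"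
      proof (cases "x = 1")
        case True then show ?thesis unfolding i_def I_def using N by (auto simp: of_nat_diff divide_simps)
      next
        case False
        then have "0 \<le> x * N" "x * N < N" using x N by auto
        then have *: "real (nat \<lfloor>x * N\<rfloor>) \<le> x * N" "x * N < real (nat \<lfloor>x * N\<rfloor>) + 1" by linarith+
        then have "nat \<lfloor>x * N\<rfloor> < N" using \<open>x * N < N\<close> by linarith
        then show ?thesis unfolding i_def I_def using False * N by (auto simp: divide_simps)
      qed
      then show "i < N" "x \<in> I i" by auto
    qed
    have "f x \<le> indicator (I i) x * h i" using fh[OF i] i by simp
    also have "\<dots> \<le> (\<Sum>i<N. indicator (I i) x * h i)"
      using i h0 by (intro member_le_sum) (auto simp: indicator_def)
    finally show ?thesis .
  qed
  have int: "integrable unit_lborel (\<lambda>x. indicator (I i) x * h i)" for i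
    by (rule integrable_unit_bounded[where C = "\<bar>h i\<bar>"]) (auto simp: I_def indicator_def)
  have meas: "(\<integral>x. indicator (I i) x * h i \<partial>unit_lborel) = h i / N" if "i < N" for i
  proof -
    have "I i \<inter> {0..1} = I i" unfolding I_def using I01[OF that] by auto
    then have "(\<integral>x. indicator (I i) x * h i \<partial>unit_lborel) = measure unit_lborel (I i) * h i" by simp
    also have "measure unit_lborel (I i) = 1 / N"
      unfolding I_def using I01[OF that] N by (subst measure_unit_interval) (auto simp: divide_simps)
    finally show ?thesis by simp
  qed
  have "1 = (\<integral>x. f x \<partial>unit_lborel)" using bv_density_integral[OF f] by simp
  also have "\<dots> \<le> (\<integral>x. (\<Sum>i<N. indicator (I i) x * h i) \<partial>unit_lborel)"
    using cover by (intro integral_unit_mono bv_density_integrable[OF f] Bochner_Integration.integrable_sum int)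
  also have "\<dots> = (\<Sum>i<N. h i / N)"
    unfolding Bochner_Integration.integral_sum[OF int] by (intro sum.cong meas) auto
  also have "\<dots> = (\<Sum>i<N. h i) / N" by (simp add: sum_divide_distrib)
  also have "(\<Sum>i<N. h i) = N / 2 + (u (real N / N) - u (real 0 / N))"
    unfolding h_def sum.distrib by (subst sum_lessThan_telescope[where f = "\<lambda>i. u (real i / N)"]) simp
  also have "\<dots> \<le> N / 2 + V" using V N by simp
  finally have "N \<le> N / 2 + V" using N by (simp add: field_simps)
  then show False using N by simp
qed

lemma uniform_minorization:
  "\<exists>n c. 0 < c \<and> c \<le> 1/2 \<and> (\<forall>f. bv_density K f \<longrightarrow> (\<forall>y\<in>{0..1}. c \<le> (P ^^ n) f y))"
proof -
  obtain N where N: "2 * K < real N" using reals_Archimedean2 by blast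
  then have N0: "0 < N" using K_ge_1 by (intro gr0I) auto
  define cell where "cell i = {real i / N..(real i + 1) / N}" for i
  have cell: "0 \<le> real i / N" "real i / N < (real i + 1) / N" "(real i + 1) / N \<le> 1" if "i < N" for i
    using that N0 by (auto simp: divide_simps)
  have "\<forall>i\<in>{..<N}. \<exists>n. {0..1} \<subseteq> (T ^^ n) ` cell i"
    unfolding cell_def using locally_eventually_onto[OF cell] by simp
  from bchoice[OF this] obtain k where k: "{0..1} \<subseteq> (T ^^ k i) ` cell i" if "i < N" for i
    by auto
  define n where "n = (\<Sum>i<N. k i)"
  have onto: "{0..1} \<subseteq> (T ^^ n) ` cell i" if i: "i < N" for i
  proof -
    have "k i \<le> n" unfolding n_def using i by (intro member_le_sum) auto
    then show ?thesis using locally_eventually_onto_later[OF k[OF i], of "n - k i"] by simp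
  qed
  define \<kappa> where "\<kappa> = min (min l m) (min A B)"
  have \<kappa>: "0 < \<kappa>" "\<kappa> \<le> l" "\<kappa> \<le> m" "\<kappa> \<le> A" "\<kappa> \<le> B"
    unfolding \<kappa>_def using l0 m0 A0 B0 by auto
  have \<kappa>1: "\<kappa> ^ n \<le> 1" using \<kappa> l_half by (intro power_le_one) auto
  have "\<kappa> ^ n / 2 \<le> (P ^^ n) f y" if f: "bv_density K f" and y: "y \<in> {0..1}" for f y
  proof -
    obtain i where i: "i < N" and half: "\<And>x. x \<in> cell i \<Longrightarrow> 1/2 \<le> f x"
      using bv_density_large_on_cell[OF f N N0] unfolding cell_def by blast
    obtain x where x: "x \<in> cell i" "y = (T ^^ n) x" using onto[OF i] y by blast
    have x01: "x \<in> {0..1}" using x(1) cell[OF i] unfolding cell_def atLeastAtMost_iff by linarith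
    have "\<kappa> ^ n * (1/2) \<le> \<kappa> ^ n * f x" using half[OF x(1)] \<kappa> by (intro mult_left_mono) auto
    also have "\<dots> \<le> (P ^^ n) f y"
      unfolding x(2) using bv_density_nonneg[OF f] \<kappa> x01 by (intro P_pow_along_orbit) auto
    finally show ?thesis by simp
  qed
  moreover have "0 < \<kappa> ^ n / 2" "\<kappa> ^ n / 2 \<le> 1/2" using \<kappa> \<kappa>1 by auto
  ultimately show ?thesis by blast
qed

lemma subtract_constant:
  assumes f: "bv_density K f" and c: "0 < c" "c \<le> 1/2" and le: "\<And>x. x \<in> {0..1} \<Longrightarrow> c \<le> f x"
  shows "bv_density (2 * K) (\<lambda>x. (1 / (1 - c)) * f x + (- c / (1 - c)) * 1)"
proof -
  have meas[measurable]: "f \<in> borel_measurable borel" by (rule bv_density_measurable[OF f])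
  from f obtain u where V: "u 1 - u 0 \<le> K"
    and u: "\<And>x y. 0 \<le> x \<Longrightarrow> x \<le> y \<Longrightarrow> y \<le> 1 \<Longrightarrow> \<bar>f y - f x\<bar> \<le> u y - u x"
    unfolding bv_density_def by blast
  have eq: "(1 / (1 - c)) * f x + (- c / (1 - c)) * 1 = (f x - c) / (1 - c)" for x
    by (simp add: diff_divide_distrib)
  have "(\<integral>x. (f x - c) / (1 - c) \<partial>unit_lborel) = 1"
    using c bv_density_integrable[OF f] bv_density_integral[OF f] unit.prob_space by simp
  moreover have "u 1 / (1 - c) - u 0 / (1 - c) \<le> 2 * K"
  proof -
    have "u 1 - u 0 \<le> K * 1" using V by simp
    also have "\<dots> \<le> K * (2 * (1 - c))" using K_ge_1 c by (intro mult_left_mono) auto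
    finally have "u 1 - u 0 \<le> 2 * K * (1 - c)" by (simp only: mult_ac)
    then have "(u 1 - u 0) / (1 - c) \<le> 2 * K" using c by (subst pos_divide_le_eq) auto
    then show ?thesis by (simp only: diff_divide_distrib)
  qed
  moreover have "\<bar>(f y - c) / (1 - c) - (f x - c) / (1 - c)\<bar> \<le> u y / (1 - c) - u x / (1 - c)"
    if "0 \<le> x" "x \<le> y" "y \<le> 1" for x y
  proof -
    have "(f y - c) / (1 - c) - (f x - c) / (1 - c) = (f y - f x) / (1 - c)"
      by (simp add: diff_divide_distrib)
    then show ?thesis using u[OF that] c by (simp add: divide_right_mono flip: diff_divide_distrib)
  qed
  moreover have "\<forall>x\<in>{0..1}. 0 \<le> (f x - c) / (1 - c)" using le c by simp
  moreover have "(\<lambda>x. (f x - c) / (1 - c)) \<in> borel_measurable borel" by measurable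
  ultimately show ?thesis
    unfolding eq bv_density_def by (intro conjI exI[of _ "\<lambda>x. u x / (1 - c)"]) blast+
qed

text \<open>After \<open>n\<close> steps two densities have the common part \<open>c\<close>. What remains has mass \<open>1 - c\<close> and, after
renormalization, at most doubled variation, which further steps bring back below \<open>K\<close>. So the
difference of two densities of the class is \<open>1 - c\<close> times another such difference.\<close>

lemma contraction_step:
  "\<exists>N c. 0 < c \<and> c \<le> 1/2 \<and> (\<forall>f g. bv_density K f \<longrightarrow> bv_density K g \<longrightarrow>
     (\<exists>f' g'. bv_density K f' \<and> bv_density K g' \<and>
        (\<forall>x. (P ^^ N) f x - (P ^^ N) g x = (1 - c) * (f' x - g' x))))"
proof -
  obtain n c where c: "0 < c" "c \<le> 1/2" and low: "\<And>f y. bv_density K f \<Longrightarrow> y \<in> {0..1} \<Longrightarrow> c \<le> (P ^^ n) f y"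
    using uniform_minorization by blast
  obtain k where k: "\<And>f. bv_density (2 * K) f \<Longrightarrow> bv_density K ((P ^^ k) f)"
    using bv_density_contract by blast
  define R where "R f = (P ^^ k) (\<lambda>x. (1 / (1 - c)) * (P ^^ n) f x + (- c / (1 - c)) * 1)" for f
  have R: "bv_density K (R f)" if "bv_density K f" for f
    unfolding R_def using that low by (intro k subtract_constant bv_density_P_pow c) auto
  have eq: "(P ^^ (k + n)) f x - (P ^^ (k + n)) g x = (1 - c) * (R f x - R g x)" for f g x
  proof -
    have "(1 - c) * ((1 / (1 - c) * X + q) - (1 / (1 - c) * Y + q)) = X - Y" for X Y q
      using c by (simp flip: diff_divide_distrib)
    then show ?thesis unfolding R_def transfer_pow_linear by (simp only: funpow_add o_apply)
  qed
  have "\<exists>f' g'. bv_density K f' \<and> bv_density K g' \<and>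
        (\<forall>x. (P ^^ (k + n)) f x - (P ^^ (k + n)) g x = (1 - c) * (f' x - g' x))"
    if "bv_density K f" "bv_density K g" for f g
    using R[OF that(1)] R[OF that(2)] eq by (intro exI[of _ "R f"] exI[of _ "R g"]) simp
  with c show ?thesis by blast
qed

text \<open>Differences of densities of the class are bounded by \<open>1 + K\<close>, so the geometric decay of the factor
gives convergence in the supremum norm, uniformly in the two densities.\<close>

lemma uniform_contraction:
  assumes "0 < e"
  shows "\<exists>n0. \<forall>n\<ge>n0. \<forall>f g. bv_density K f \<longrightarrow> bv_density K g \<longrightarrow>
    (\<forall>x\<in>{0..1}. \<bar>(P ^^ n) f x - (P ^^ n) g x\<bar> \<le> e)"
proof -
  obtain N c where c: "0 < c" "c \<le> 1/2" and step: "\<And>f g. bv_density K f \<Longrightarrow> bv_density K g \<Longrightarrow>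
     \<exists>f' g'. bv_density K f' \<and> bv_density K g' \<and> (\<forall>x. (P ^^ N) f x - (P ^^ N) g x = (1 - c) * (f' x - g' x))"
    using contraction_step by blast
  have iter: "\<exists>f' g'. bv_density K f' \<and> bv_density K g' \<and>
      (\<forall>x. (P ^^ (j * N)) f x - (P ^^ (j * N)) g x = (1 - c) ^ j * (f' x - g' x))"
    if f: "bv_density K f" and g: "bv_density K g" for f g j
  proof (induction j)
    case 0 show ?case using f g by (intro exI[of _ f] exI[of _ g]) simp
  next
    case (Suc j)
    then obtain f1 g1 where 1: "bv_density K f1" "bv_density K g1"
      "\<And>x. (P ^^ (j * N)) f x - (P ^^ (j * N)) g x = (1 - c) ^ j * (f1 x - g1 x)" by blast
    from step[OF 1(1,2)] obtain f2 g2 where 2: "bv_density K f2" "bv_density K g2"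
      "\<And>x. (P ^^ N) f1 x - (P ^^ N) g1 x = (1 - c) * (f2 x - g2 x)" by blast
    have "(P ^^ (Suc j * N)) f x - (P ^^ (Suc j * N)) g x = (1 - c) ^ Suc j * (f2 x - g2 x)" for x
    proof -
      have lin: "(P ^^ N) (\<lambda>x. a x - b x) = (\<lambda>x. (P ^^ N) a x - (P ^^ N) b x)" for a b
        using transfer_pow_linear[where a = 1 and b = "-1" and f = a and g = b] by simp
      have smult: "(P ^^ N) (\<lambda>x. r * a x) = (\<lambda>x. r * (P ^^ N) a x)" for r a
        using transfer_pow_linear[where a = r and b = 0 and f = a and g = a] by simp
      have "(P ^^ (Suc j * N)) f x - (P ^^ (Suc j * N)) g x
          = (P ^^ N) (\<lambda>x. (P ^^ (j * N)) f x - (P ^^ (j * N)) g x) x"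
        unfolding lin by (simp add: funpow_add)
      also have "\<dots> = (1 - c) ^ j * ((P ^^ N) f1 x - (P ^^ N) g1 x)"
        unfolding 1(3) smult lin ..
      also have "\<dots> = (1 - c) ^ Suc j * (f2 x - g2 x)" unfolding 2(3) by simp
      finally show ?thesis .
    qed
    with 2 show ?case by blast
  qed
  have "(\<lambda>j. (1 - c) ^ j) \<longlonglongrightarrow> 0" using c by (intro LIMSEQ_power_zero) auto
  then have "eventually (\<lambda>j. (1 - c) ^ j < e / (1 + K)) sequentially"
    using assms K_ge_1 by (intro order_tendstoD(2)) auto
  then obtain j where "(1 - c) ^ j < e / (1 + K)" by (auto simp: eventually_sequentially)
  then have j: "(1 - c) ^ j * (1 + K) \<le> e" using K_ge_1 by (simp add: field_simps)
  show ?thesis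
  proof (intro exI allI impI ballI)
    fix n f g and x :: real
    assume n: "j * N \<le> n" and f: "bv_density K f" and g: "bv_density K g" and x: "x \<in> {0..1}"
    obtain f' g' where fg: "bv_density K f'" "bv_density K g'"
      "\<And>x. (P ^^ (j * N)) ((P ^^ (n - j * N)) f) x - (P ^^ (j * N)) ((P ^^ (n - j * N)) g) x
         = (1 - c) ^ j * (f' x - g' x)"
      using iter[OF bv_density_P_pow[OF f] bv_density_P_pow[OF g], of j "n - j * N" "n - j * N"] by blast
    have split: "(P ^^ n) a = (P ^^ (j * N)) ((P ^^ (n - j * N)) a)" for a
      using n by (metis comp_apply funpow_add le_add_diff_inverse)
    have "\<bar>f' x - g' x\<bar> \<le> 1 + K"
      using bv_density_nonneg[OF fg(1) x] bv_density_nonneg[OF fg(2) x]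
        bv_density_le[OF fg(1) x] bv_density_le[OF fg(2) x] by linarith
    then have "\<bar>(1 - c) ^ j * (f' x - g' x)\<bar> \<le> (1 - c) ^ j * (1 + K)"
      using c by (simp add: abs_mult mult_left_mono)
    then show "\<bar>(P ^^ n) f x - (P ^^ n) g x\<bar> \<le> e" unfolding split fg(3) using j by linarith
  qed
qed

section \<open>The invariant density\<close>

definition inv_density where "inv_density x = indicator {0..1} x * lim (\<lambda>n. (P ^^ n) (\<lambda>_. 1) x)"

lemma inv_density_lim:
  assumes x: "x \<in> {0..1}" shows "(\<lambda>n. (P ^^ n) (\<lambda>_. 1) x) \<longlonglongrightarrow> inv_density x"
proof -
  have "Cauchy (\<lambda>n. (P ^^ n) (\<lambda>_. 1) x)"
  proof (rule CauchyI)
    fix e :: real assume "0 < e"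
    then have "0 < e/2" by simp
    from uniform_contraction[OF this] obtain n0 where
      n0: "\<And>f g. bv_density K f \<Longrightarrow> bv_density K g \<Longrightarrow> \<bar>(P ^^ n0) f x - (P ^^ n0) g x\<bar> \<le> e/2"
      using x by blast
    have split: "(P ^^ i) a = (P ^^ n0) ((P ^^ (i - n0)) a)" if "n0 \<le> i" for i a
      using that by (metis comp_apply funpow_add le_add_diff_inverse)
    have "norm ((P ^^ i) (\<lambda>_. 1) x - (P ^^ j) (\<lambda>_. 1) x) < e" if "n0 \<le> i" "n0 \<le> j" for i j
      using n0[OF bv_density_P_pow[OF bv_density_one] bv_density_P_pow[OF bv_density_one], of "i - n0" "j - n0"] \<open>0 < e\<close>
      unfolding split[OF that(1)] split[OF that(2)] by simp
    then show "\<exists>M. \<forall>i\<ge>M. \<forall>j\<ge>M. norm ((P ^^ i) (\<lambda>_. 1) x - (P ^^ j) (\<lambda>_. 1) x) < e" by blast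
  qed
  then show ?thesis using x unfolding inv_density_def by (simp add: Cauchy_convergent convergent_LIMSEQ_iff[symmetric])
qed

lemma P_pow_one: "bv_density K ((P ^^ n) (\<lambda>_. 1))"
  by (rule bv_density_P_pow[OF bv_density_one])

lemma inv_density_measurable [measurable]: "inv_density \<in> borel_measurable borel"
proof (rule borel_measurable_LIMSEQ_metric)
  show "(\<lambda>x. indicator {0..1} x * (P ^^ n) (\<lambda>_. 1) x) \<in> borel_measurable borel" for n
    using bv_density_measurable[OF P_pow_one[of n]] by measurable
  show "(\<lambda>n. indicator {0..1} x * (P ^^ n) (\<lambda>_. 1) x) \<longlonglongrightarrow> inv_density x" for x
    using inv_density_lim[of x] by (cases "x \<in> {0..1}") (auto simp: inv_density_def)
qed

lemma inv_density_nonneg: "x \<in> {0..1} \<Longrightarrow> 0 \<le> inv_density x"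
  by (rule LIMSEQ_le_const[OF inv_density_lim]) (blast intro: bv_density_nonneg[OF P_pow_one])+

lemma inv_density_le: "x \<in> {0..1} \<Longrightarrow> inv_density x \<le> 1 + K"
  by (rule LIMSEQ_le_const2[OF inv_density_lim]) (blast intro: bv_density_le[OF P_pow_one])+

text \<open>The uniformity in \<open>f\<close> is what the stability argument rests on.\<close>

lemma P_pow_uniform_limit:
  assumes "0 < e"
  shows "\<exists>n0. \<forall>n\<ge>n0. \<forall>f. bv_density K f \<longrightarrow> (\<forall>x\<in>{0..1}. \<bar>(P ^^ n) f x - inv_density x\<bar> \<le> e)"
proof -
  from uniform_contraction[OF assms] obtain n0 where
    contr: "\<forall>n\<ge>n0. \<forall>f g. bv_density K f \<longrightarrow> bv_density K g \<longrightarrow>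
      (\<forall>x\<in>{0..1}. \<bar>(P ^^ n) f x - (P ^^ n) g x\<bar> \<le> e)" ..
  note n0 = contr[rule_format]
  show ?thesis
  proof (intro exI allI impI ballI)
    fix n f and x :: real assume *: "n0 \<le> n" "bv_density K f" "x \<in> {0..1}"
    have "(\<lambda>j. (P ^^ (j + n)) (\<lambda>_. 1) x) \<longlonglongrightarrow> inv_density x"
      by (rule LIMSEQ_ignore_initial_segment[OF inv_density_lim[OF *(3)]])
    then have "(\<lambda>j. (P ^^ n) ((P ^^ j) (\<lambda>_. 1)) x) \<longlonglongrightarrow> inv_density x"
      by (simp add: funpow_add add.commute[of _ n])
    then have lim: "(\<lambda>j. \<bar>(P ^^ n) f x - (P ^^ n) ((P ^^ j) (\<lambda>_. 1)) x\<bar>) \<longlonglongrightarrow> \<bar>(P ^^ n) f x - inv_density x\<bar>"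
      by (intro tendsto_intros)
    have "\<bar>(P ^^ n) f x - (P ^^ n) ((P ^^ j) (\<lambda>_. 1)) x\<bar> \<le> e" for j
      by (rule n0[OF *(1,2) P_pow_one *(3)])
    then show "\<bar>(P ^^ n) f x - inv_density x\<bar> \<le> e"
      by (intro LIMSEQ_le_const2[OF lim] exI allI impI)
  qed
qed

lemma P_pow_tendsto:
  assumes f: "bv_density K f" and x: "x \<in> {0..1}" shows "(\<lambda>n. (P ^^ n) f x) \<longlonglongrightarrow> inv_density x"
proof (rule LIMSEQ_I)
  fix e :: real assume "0 < e"
  then have "0 < e/2" by simp
  from P_pow_uniform_limit[OF this] obtain n0 where n0: "\<bar>(P ^^ n) f x - inv_density x\<bar> \<le> e/2" if "n0 \<le> n" for n
    using f x by blast
  have "norm ((P ^^ n) f x - inv_density x) < e" if "n0 \<le> n" for n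
    using n0[OF that] \<open>0 < e\<close> by simp
  then show "\<exists>n0. \<forall>n\<ge>n0. norm ((P ^^ n) f x - inv_density x) < e" by blast
qed

lemma integral_P_pow_tendsto:
  fixes \<phi> :: "real \<Rightarrow> real"
  assumes f: "bv_density K f" and [measurable]: "\<phi> \<in> borel_measurable borel"
    and D: "\<And>x. x \<in> {0..1} \<Longrightarrow> \<bar>\<phi> x\<bar> \<le> D"
  shows "(\<lambda>n. \<integral>x. \<phi> x * (P ^^ n) f x \<partial>unit_lborel) \<longlonglongrightarrow> (\<integral>x. \<phi> x * inv_density x \<partial>unit_lborel)"
proof (rule dominated_unit)
  show "(\<lambda>x. \<phi> x * (P ^^ n) f x) \<in> borel_measurable borel" for n
    using bv_density_measurable[OF bv_density_P_pow[OF f, of n]] by measurable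
  show "(\<lambda>n. \<phi> x * (P ^^ n) f x) \<longlonglongrightarrow> \<phi> x * inv_density x" if "x \<in> {0..1}" for x
    by (intro tendsto_intros P_pow_tendsto f that)
  show "\<bar>\<phi> x * (P ^^ n) f x\<bar> \<le> D * (1 + K)" if "x \<in> {0..1}" for n x
    unfolding abs_mult using D[OF that] bv_density_abs_le[OF bv_density_P_pow[OF f] that]
    by (intro mult_mono) auto
qed simp

lemma inv_density_integral: "(\<integral>x. inv_density x \<partial>unit_lborel) = 1"
  using integral_P_pow_tendsto[OF bv_density_one, of "\<lambda>_. 1" 1] bv_density_integral[OF P_pow_one]
  by (simp add: LIMSEQ_const_iff)

lemma inv_density_invariant:
  fixes \<phi> :: "real \<Rightarrow> real"
  assumes [measurable]: "\<phi> \<in> borel_measurable borel" and D: "\<And>x. x \<in> {0..1} \<Longrightarrow> \<bar>\<phi> x\<bar> \<le> D"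
  shows "(\<integral>x. \<phi> (T x) * inv_density x \<partial>unit_lborel) = (\<integral>x. \<phi> x * inv_density x \<partial>unit_lborel)"
proof (rule LIMSEQ_unique)
  show "(\<lambda>n. \<integral>x. \<phi> (T x) * (P ^^ n) (\<lambda>_. 1) x \<partial>unit_lborel) \<longlonglongrightarrow> (\<integral>x. \<phi> (T x) * inv_density x \<partial>unit_lborel)"
    using D T_unit by (intro integral_P_pow_tendsto[where D = D] bv_density_one) auto
  have "(\<integral>x. \<phi> (T x) * (P ^^ n) (\<lambda>_. 1) x \<partial>unit_lborel) = (\<integral>x. \<phi> x * (P ^^ Suc n) (\<lambda>_. 1) x \<partial>unit_lborel)" for n
    using duality[OF bv_density_measurable[OF P_pow_one[of n]] assms(1) bv_density_abs_le[OF P_pow_one[of n]] D] by simp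
  then show "(\<lambda>n. \<integral>x. \<phi> (T x) * (P ^^ n) (\<lambda>_. 1) x \<partial>unit_lborel) \<longlonglongrightarrow> (\<integral>x. \<phi> x * inv_density x \<partial>unit_lborel)"
    using LIMSEQ_Suc[OF integral_P_pow_tendsto[OF bv_density_one assms]] by simp
qed

section \<open>Every integrable function mixes\<close>

text \<open>The weight \<open>f\<close> is spread out by the map so that the integrals of \<open>\<phi> \<circ> T ^^ n\<close> against it approach
those against a multiple of the invariant density. For a density \<open>f\<close> of an absolutely continuous
invariant measure these integrals do not depend on \<open>n\<close>, so that this property identifies the measure.\<close>

definition mixes :: "(real \<Rightarrow> real) \<Rightarrow> (real \<Rightarrow> real) \<Rightarrow> bool" where
  "mixes \<phi> f \<longleftrightarrow> integrable unit_lborel f \<and>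
     (\<lambda>n. \<integral>x. \<phi> ((T ^^ n) x) * f x \<partial>unit_lborel)
       \<longlonglongrightarrow> (\<integral>x. \<phi> x * inv_density x \<partial>unit_lborel) * (\<integral>x. f x \<partial>unit_lborel)"

context
  fixes \<phi> :: "real \<Rightarrow> real" and D :: real
  assumes \<phi> [measurable]: "\<phi> \<in> borel_measurable borel" and D: "\<And>x. x \<in> {0..1} \<Longrightarrow> \<bar>\<phi> x\<bar> \<le> D"
begin

lemma integrable_pullback:
  assumes f: "integrable unit_lborel f"
  shows "integrable unit_lborel (\<lambda>x. \<phi> ((T ^^ n) x) * f x)"
proof (rule Bochner_Integration.integrable_bound[where f = "\<lambda>x. D * f x"])
  show "integrable unit_lborel (\<lambda>x. D * f x)" using f by simp
  show "(\<lambda>x. \<phi> ((T ^^ n) x) * f x) \<in> borel_measurable unit_lborel"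
  proof (rule borel_measurable_times)
    show "(\<lambda>x. \<phi> ((T ^^ n) x)) \<in> borel_measurable unit_lborel" by (rule measurable_unit) measurable
    show "f \<in> borel_measurable unit_lborel" using f by (rule borel_measurable_integrable)
  qed
  show "AE x in unit_lborel. norm (\<phi> ((T ^^ n) x) * f x) \<le> norm (D * f x)"
  proof (rule AE_I2)
    fix x assume "x \<in> space unit_lborel"
    then have "\<bar>\<phi> ((T ^^ n) x)\<bar> \<le> \<bar>D\<bar>" using D[OF T_pow_unit[of x n]] by simp
    then show "norm (\<phi> ((T ^^ n) x) * f x) \<le> norm (D * f x)"
      by (simp add: abs_mult mult_right_mono)
  qed
qed

lemma mixes_density:
  assumes f: "bv_density K f" shows "mixes \<phi> f"
proof -
  have "(\<integral>x. \<phi> ((T ^^ n) x) * f x \<partial>unit_lborel) = (\<integral>y. \<phi> y * (P ^^ n) f y \<partial>unit_lborel)" for n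
    by (rule duality_pow[OF f \<phi>]) (rule D)
  moreover have "(\<lambda>n. \<integral>x. \<phi> x * (P ^^ n) f x \<partial>unit_lborel) \<longlonglongrightarrow> (\<integral>x. \<phi> x * inv_density x \<partial>unit_lborel)"
    by (rule integral_P_pow_tendsto[OF f \<phi>]) (rule D)
  ultimately show ?thesis
    unfolding mixes_def bv_density_integral[OF f] using bv_density_integrable[OF f] by simp
qed

lemma mixes_linear:
  assumes f: "mixes \<phi> f" and g: "mixes \<phi> g"
  shows "mixes \<phi> (\<lambda>x. a * f x + b * g x)"
proof -
  have int: "integrable unit_lborel f" "integrable unit_lborel g"
    using f g by (auto simp: mixes_def)
  have "(\<integral>x. \<phi> ((T ^^ n) x) * (a * f x + b * g x) \<partial>unit_lborel)
      = a * (\<integral>x. \<phi> ((T ^^ n) x) * f x \<partial>unit_lborel) + b * (\<integral>x. \<phi> ((T ^^ n) x) * g x \<partial>unit_lborel)" for n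
  proof -
    have "(\<integral>x. \<phi> ((T ^^ n) x) * (a * f x + b * g x) \<partial>unit_lborel)
        = (\<integral>x. a * (\<phi> ((T ^^ n) x) * f x) + b * (\<phi> ((T ^^ n) x) * g x) \<partial>unit_lborel)"
      by (simp add: algebra_simps)
    then show ?thesis using integrable_pullback[OF int(1)] integrable_pullback[OF int(2)] by simp
  qed
  moreover have "(\<lambda>n. a * (\<integral>x. \<phi> ((T ^^ n) x) * f x \<partial>unit_lborel) + b * (\<integral>x. \<phi> ((T ^^ n) x) * g x \<partial>unit_lborel))
      \<longlonglongrightarrow> a * ((\<integral>x. \<phi> x * inv_density x \<partial>unit_lborel) * (\<integral>x. f x \<partial>unit_lborel))
        + b * ((\<integral>x. \<phi> x * inv_density x \<partial>unit_lborel) * (\<integral>x. g x \<partial>unit_lborel))"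
    using f g by (intro tendsto_intros) (auto simp: mixes_def)
  ultimately show ?thesis unfolding mixes_def using int by (simp add: algebra_simps)
qed

text \<open>The integrals of \<open>\<phi> \<circ> T ^^ n\<close> against \<open>f\<close> are Lipschitz in \<open>f\<close> for the \<open>L\<^sup>1\<close> distance, uniformly in \<open>n\<close>. Hence the class is
closed, and the densities of bounded variation suffice to reach all integrable functions.\<close>

lemma mixes_L1_limit:
  assumes f: "integrable unit_lborel f" and s: "\<And>k. mixes \<phi> (s k)"
    and lim: "(\<lambda>k. \<integral>x. \<bar>f x - s k x\<bar> \<partial>unit_lborel) \<longlonglongrightarrow> (0::real)"
  shows "mixes \<phi> f"
proof -
  define c where "c = (\<integral>x. \<phi> x * inv_density x \<partial>unit_lborel)"
  have D0: "0 \<le> D" by (rule order_trans[OF abs_ge_zero D[of 0]]) simp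
  have si: "integrable unit_lborel (s k)" for k using s by (simp add: mixes_def)
  have "(\<lambda>n. \<integral>x. \<phi> ((T ^^ n) x) * f x \<partial>unit_lborel) \<longlonglongrightarrow> c * (\<integral>x. f x \<partial>unit_lborel)"
  proof (rule LIMSEQ_I)
    fix e :: real assume e: "0 < e"
    define b where "b = D + \<bar>c\<bar> + 1"
    have b: "0 < b" unfolding b_def using D0 by simp
    have "eventually (\<lambda>k. (\<integral>x. \<bar>f x - s k x\<bar> \<partial>unit_lborel) < e / (2 * b)) sequentially"
      using e b by (intro order_tendstoD(2)[OF lim]) simp
    from eventually_happens'[OF sequentially_bot this]
    obtain k where k: "(\<integral>x. \<bar>f x - s k x\<bar> \<partial>unit_lborel) < e / (2 * b)" ..
    define r where "r = (\<integral>x. \<bar>f x - s k x\<bar> \<partial>unit_lborel)"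
    have rb: "b * r < e / 2" using k b unfolding r_def by (simp add: field_simps)
    have r0: "0 \<le> r" unfolding r_def by simp
    have fs: "integrable unit_lborel (\<lambda>x. f x - s k x)" using f si by simp
    have 1: "\<bar>(\<integral>x. \<phi> ((T ^^ n) x) * f x \<partial>unit_lborel) - (\<integral>x. \<phi> ((T ^^ n) x) * s k x \<partial>unit_lborel)\<bar> \<le> D * r" for n
    proof -
      have eq: "(\<integral>x. \<phi> ((T ^^ n) x) * f x \<partial>unit_lborel) - (\<integral>x. \<phi> ((T ^^ n) x) * s k x \<partial>unit_lborel)
          = (\<integral>x. \<phi> ((T ^^ n) x) * (f x - s k x) \<partial>unit_lborel)"
        using integrable_pullback[OF f] integrable_pullback[OF si] by (simp add: right_diff_distrib)
      have "\<bar>\<integral>x. \<phi> ((T ^^ n) x) * (f x - s k x) \<partial>unit_lborel\<bar>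
          \<le> (\<integral>x. \<bar>\<phi> ((T ^^ n) x) * (f x - s k x)\<bar> \<partial>unit_lborel)"
        by (rule integral_abs_bound)
      also have "\<dots> \<le> (\<integral>x. D * \<bar>f x - s k x\<bar> \<partial>unit_lborel)"
      proof (rule integral_unit_mono)
        show "\<bar>\<phi> ((T ^^ n) x) * (f x - s k x)\<bar> \<le> D * \<bar>f x - s k x\<bar>" if "x \<in> {0..1}" for x
          unfolding abs_mult by (rule mult_right_mono[OF D[OF T_pow_unit[OF that]]]) simp
      qed (use fs integrable_pullback[OF fs] in auto)
      finally show ?thesis unfolding eq r_def by simp
    qed
    have 2: "\<bar>c * (\<integral>x. s k x \<partial>unit_lborel) - c * (\<integral>x. f x \<partial>unit_lborel)\<bar> \<le> \<bar>c\<bar> * r"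
    proof -
      have "\<bar>(\<integral>x. f x \<partial>unit_lborel) - (\<integral>x. s k x \<partial>unit_lborel)\<bar> \<le> r"
        unfolding r_def using integral_abs_bound[of unit_lborel "\<lambda>x. f x - s k x"] f si by simp
      then have "\<bar>c\<bar> * \<bar>(\<integral>x. s k x \<partial>unit_lborel) - (\<integral>x. f x \<partial>unit_lborel)\<bar> \<le> \<bar>c\<bar> * r"
        by (intro mult_left_mono) auto
      then show ?thesis by (simp add: abs_mult flip: right_diff_distrib)
    qed
    have "(\<lambda>n. \<integral>x. \<phi> ((T ^^ n) x) * s k x \<partial>unit_lborel) \<longlonglongrightarrow> c * (\<integral>x. s k x \<partial>unit_lborel)"
      using s[of k] unfolding mixes_def c_def by (rule conjunct2)
    from LIMSEQ_D[OF this, of "e / 2"] e obtain n0 where n0: "\<And>n. n0 \<le> n \<Longrightarrow>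
        \<bar>(\<integral>x. \<phi> ((T ^^ n) x) * s k x \<partial>unit_lborel) - c * (\<integral>x. s k x \<partial>unit_lborel)\<bar> < e / 2"
      unfolding real_norm_def by auto
    have "\<bar>(\<integral>x. \<phi> ((T ^^ n) x) * f x \<partial>unit_lborel) - c * (\<integral>x. f x \<partial>unit_lborel)\<bar> < e" if "n0 \<le> n" for n
    proof -
      have "D * r + \<bar>c\<bar> * r \<le> b * r" unfolding b_def using r0 by (simp add: algebra_simps)
      then show ?thesis using 1[of n] 2 n0[OF that] rb by linarith
    qed
    then show "\<exists>n0. \<forall>n\<ge>n0. norm ((\<integral>x. \<phi> ((T ^^ n) x) * f x \<partial>unit_lborel) - c * (\<integral>x. f x \<partial>unit_lborel)) < e"
      unfolding real_norm_def by blast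
  qed
  then show ?thesis unfolding mixes_def c_def using f by simp
qed

lemma integrable_indicator_unit: "E \<in> sets borel \<Longrightarrow> integrable unit_lborel (indicator E :: real \<Rightarrow> real)"
  by (rule integrable_unit_bounded[where C = 1]) (auto simp: indicator_def)

text \<open>The indicator need not have positive mean on the unit interval; adding the constant 1 makes it
possible to normalize it to a density, whose variation is at most \<open>1 \<le> K\<close>.\<close>

lemma mixes_initial_segment: "mixes \<phi> (indicator {..a})"
proof -
  define i where "i = measure unit_lborel {0..min a 1}"
  have i: "0 \<le> i" unfolding i_def by simp
  define g where "g = (\<lambda>x. (1 / (1 + i)) * 1 + (1 / (1 + i)) * indicator {..a} x :: real)"
  have ii: "integrable unit_lborel (indicator {..a} :: real \<Rightarrow> real)"
    by (rule integrable_indicator_unit) simp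
  have "bv_density 1 g"
    unfolding bv_density_def
  proof (intro conjI exI[of _ "\<lambda>x. - g x"])
    show "(\<integral>x. g x \<partial>unit_lborel) = 1"
      unfolding g_def using ii i unit.prob_space
      by (simp add: i_def[symmetric] flip: add_divide_distrib)
    show "\<forall>x y. 0 \<le> x \<and> x \<le> y \<and> y \<le> 1 \<longrightarrow> \<bar>g y - g x\<bar> \<le> - g y - - g x"
      unfolding g_def using i by (auto simp: indicator_def)
  qed (use i in \<open>auto simp: g_def indicator_def\<close>)
  then have "mixes \<phi> g" using K_ge_1 by (intro mixes_density) (rule bv_density_mono)
  from mixes_linear[OF this mixes_density[OF bv_density_one], of "1 + i" "-1"]
  have "mixes \<phi> (\<lambda>x. (1 + i) * g x + - 1 * 1)" .
  moreover have "(1 + i) * g x + - 1 * 1 = indicator {..a} x" for x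
    unfolding g_def using i by (simp add: distrib_left)
  ultimately show ?thesis by simp
qed

text \<open>Half-lines are an intersection-stable generator of the Borel sets, and the sets with mixing
indicator form a Dynkin system.\<close>

lemma mixes_indicator:
  assumes "E \<in> sets borel" shows "mixes \<phi> (indicator E)"
proof -
  have E: "E \<in> sigma_sets UNIV (range (\<lambda>a::real. {..a}))"
    using assms by (simp add: borel_eq_atMost)
  have "Int_stable (range (\<lambda>a::real. {..a}))" by (auto simp: Int_stable_def)
  then show ?thesis
    using subset_UNIV[of "range (\<lambda>a::real. {..a})"] E unfolding Pow_UNIV[symmetric]
  proof (induct rule: sigma_sets_induct_disjoint)
    case (basic E) then show ?case using mixes_initial_segment by auto
  next
    case empty
    show ?case using mixes_linear[OF mixes_density mixes_density, OF bv_density_one bv_density_one, of 0 0] by simp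
  next
    case (compl E)
    have "(indicator (UNIV - E) :: real \<Rightarrow> real) = (\<lambda>x. 1 * 1 + (-1) * indicator E x)"
      by (auto simp: indicator_def)
    then show ?case using mixes_linear[OF mixes_density[OF bv_density_one] compl(2), of 1 "-1"] by simp
  next
    case (union F)
    have F[measurable]: "F i \<in> sets borel" for i
      using union(2) by (simp add: borel_eq_atMost range_subsetD)
    define S where "S k = (\<Union>i<k. F i)" for k
    have S[measurable]: "S k \<in> sets borel" for k unfolding S_def by measurable
    have mix: "mixes \<phi> (indicator (S k))" for k
    proof (induction k)
      case 0
      show ?case using mixes_linear[OF mixes_density mixes_density, OF bv_density_one bv_density_one, of 0 0]
        by (simp add: S_def)
    next
      case (Suc k)
      have "F i \<inter> F k = {}" if "i < k" for i
        using union(1) that by (simp add: disjoint_family_on_def)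
      then have "S k \<inter> F k = {}" unfolding S_def by blast
      moreover have "S (Suc k) = S k \<union> F k" unfolding S_def by (auto simp: less_Suc_eq)
      ultimately have "(indicator (S (Suc k)) :: real \<Rightarrow> real) = (\<lambda>x. 1 * indicator (S k) x + 1 * indicator (F k) x)"
        by (auto simp: indicator_def fun_eq_iff)
      then show ?case using mixes_linear[OF Suc union(3)[of k], of 1 1] by simp
    qed
    show ?case
    proof (rule mixes_L1_limit[OF _ mix])
      show "integrable unit_lborel (indicator (\<Union>i. F i) :: real \<Rightarrow> real)"
        by (rule integrable_indicator_unit) measurable
      have "(\<lambda>k. \<integral>x. \<bar>indicator (\<Union>i. F i) x - indicator (S k) x\<bar> \<partial>unit_lborel) \<longlonglongrightarrow> (\<integral>x. 0 \<partial>unit_lborel :: real)"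
      proof (rule dominated_unit[where C = 1])
        fix x :: real
        have "eventually (\<lambda>k. \<bar>indicator (\<Union>i. F i) x - indicator (S k) x :: real\<bar> = 0) sequentially"
        proof (cases "\<exists>i. x \<in> F i")
          case True
          then obtain i where "x \<in> F i" by blast
          then have "x \<in> S k" if "i < k" for k using that unfolding S_def by blast
          then show ?thesis using True
            by (auto simp: eventually_sequentially indicator_def intro!: exI[of _ "Suc i"])
        qed (auto simp: S_def)
        then show "(\<lambda>k. \<bar>indicator (\<Union>i. F i) x - indicator (S k) x\<bar>) \<longlonglongrightarrow> (0::real)"
          by (rule tendsto_eventually)
      qed (auto simp: indicator_def)
      then show "(\<lambda>k. \<integral>x. \<bar>indicator (\<Union>i. F i) x - indicator (S k) x\<bar> \<partial>unit_lborel) \<longlonglongrightarrow> (0::real)"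
        by simp
    qed
  qed
qed

lemma mixes_integrable:
  assumes "integrable unit_lborel f" shows "mixes \<phi> f"
  using assms
proof (induct rule: integrable_induct)
  case (base E c)
  have "E \<in> sets borel"
    using base(1) unfolding unit_lborel_def by (simp add: sets_restrict_space_iff)
  then have "mixes \<phi> (\<lambda>x. c * indicator E x + 0 * indicator E x)"
    by (intro mixes_linear mixes_indicator)
  then show ?case by (simp add: mult.commute)
next
  case (add f g)
  then show ?case using mixes_linear[OF add(2,4), of 1 1] by simp
next
  case (lim f s)
  show ?case
  proof (rule mixes_L1_limit[OF _ lim(2)])
    have "(\<lambda>k. \<integral>x. \<bar>f x - s k x\<bar> \<partial>unit_lborel) \<longlonglongrightarrow> (\<integral>x. 0 \<partial>unit_lborel :: real)"
    proof (rule integral_dominated_convergence[where w = "\<lambda>x. 3 * \<bar>f x\<bar>"])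
      show "AE x in unit_lborel. (\<lambda>k. \<bar>f x - s k x\<bar>) \<longlonglongrightarrow> 0"
      proof (rule AE_I2)
        fix x assume "x \<in> space unit_lborel"
        from tendsto_rabs[OF tendsto_diff[OF tendsto_const[of "f x"] lim(3)[OF this]]]
        show "(\<lambda>k. \<bar>f x - s k x\<bar>) \<longlonglongrightarrow> 0" by simp
      qed
      show "AE x in unit_lborel. norm \<bar>f x - s k x\<bar> \<le> 3 * \<bar>f x\<bar>" for k
      proof (rule AE_I2)
        fix x assume "x \<in> space unit_lborel"
        then have "\<bar>s k x\<bar> \<le> 2 * \<bar>f x\<bar>" using lim(4) by simp
        then show "norm \<bar>f x - s k x\<bar> \<le> 3 * \<bar>f x\<bar>" by simp
      qed
    qed (use lim(1,5) in auto)
    then show "(\<lambda>k. \<integral>x. \<bar>f x - s k x\<bar> \<partial>unit_lborel) \<longlonglongrightarrow> (0::real)" by simp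
  qed (rule lim(5))
qed

end

end

section \<open>Existence and uniqueness of the invariant measure\<close>

lemma acim_cong:
  assumes "\<And>x. x \<in> {0..1} \<Longrightarrow> S x = S' x"
  shows "acim S \<mu> \<longleftrightarrow> acim S' \<mu>"
proof (cases "sets \<mu> = sets unit_lborel")
  case True
  then have "space \<mu> = {0..1}" using sets_eq_imp_space_eq[OF True] by simp
  then have "S \<in> measurable \<mu> \<mu> \<longleftrightarrow> S' \<in> measurable \<mu> \<mu>" "distr \<mu> \<mu> S = distr \<mu> \<mu> S'"
    using assms by (auto intro!: measurable_cong distr_cong)
  then show ?thesis by (simp add: acim_def)
qed (simp add: acim_def)

lemma unit_in_sets [simp]: "{0..1} \<in> sets unit_lborel"
  using sets.top[of unit_lborel] by simp

context w_shape
begin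

definition inv_measure where "inv_measure = density unit_lborel (\<lambda>x. ennreal (inv_density x))"

lemma inv_density_measurable_unit [measurable]: "inv_density \<in> borel_measurable unit_lborel"
  by (rule measurable_unit) measurable

lemma integrable_inv_density: "integrable unit_lborel inv_density"
  by (rule integrable_unit_bounded[where C = "1 + K"]) (use inv_density_nonneg inv_density_le in \<open>auto simp: abs_le_iff\<close>)

lemma prob_space_inv_measure: "prob_space inv_measure"
proof (rule prob_spaceI)
  have "emeasure inv_measure (space inv_measure) = (\<integral>\<^sup>+x. ennreal (inv_density x) \<partial>unit_lborel)"
    unfolding inv_measure_def by (subst emeasure_density) (auto intro!: nn_integral_cong simp: indicator_def)
  also have "\<dots> = ennreal (\<integral>x. inv_density x \<partial>unit_lborel)"
    using integrable_inv_density inv_density_nonneg by (intro nn_integral_eq_integral AE_I2) auto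
  finally show "emeasure inv_measure (space inv_measure) = 1" by (simp add: inv_density_integral)
qed

lemma integral_inv_measure:
  fixes g :: "real \<Rightarrow> real"
  assumes "g \<in> borel_measurable unit_lborel"
  shows "(\<integral>x. g x \<partial>inv_measure) = (\<integral>x. g x * inv_density x \<partial>unit_lborel)"
  unfolding inv_measure_def using assms inv_density_nonneg
  by (subst integral_density) (auto simp: mult.commute)

lemma T_measurable_unit: "T \<in> measurable unit_lborel unit_lborel"
  unfolding unit_lborel_def using T_unit
  by (intro measurable_restrict_space3) auto

lemma sets_unit_iff: "E \<in> sets unit_lborel \<longleftrightarrow> E \<in> sets borel \<and> E \<subseteq> {0..1}"
  unfolding unit_lborel_def by (auto simp: sets_restrict_space_iff)

lemma acim_inv_measure: "acim T inv_measure"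
  unfolding acim_def
proof (intro conjI)
  interpret I: prob_space inv_measure by (rule prob_space_inv_measure)
  show sets: "sets inv_measure = sets unit_lborel" by (simp add: inv_measure_def)
  show "absolutely_continuous unit_lborel inv_measure"
    unfolding inv_measure_def by (rule absolutely_continuousI_density) measurable
  show T: "T \<in> measurable inv_measure inv_measure"
    using T_measurable_unit by (simp cong: measurable_cong_sets[OF sets sets])
  show "distr inv_measure inv_measure T = inv_measure"
  proof (rule measure_eqI)
    fix E assume "E \<in> sets (distr inv_measure inv_measure T)"
    then have E: "E \<in> sets inv_measure" by simp
    then have E': "E \<in> sets borel" using sets sets_unit_iff by simp
    have ind[measurable]: "(indicator E :: real \<Rightarrow> real) \<in> borel_measurable borel" using E' by simp
    have space: "space inv_measure = {0..1}" by (simp add: inv_measure_def)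
    have "measure (distr inv_measure inv_measure T) E = (\<integral>x. indicator E (T x) \<partial>inv_measure)"
    proof -
      interpret Td: prob_space "distr inv_measure inv_measure T" by (rule I.prob_space_distr[OF T])
      have "measure (distr inv_measure inv_measure T) E = (\<integral>x. indicator E x \<partial>distr inv_measure inv_measure T)"
        using E sets.sets_into_space[OF E] by (simp add: Int_absorb2)
      also have "\<dots> = (\<integral>x. indicator E (T x) \<partial>inv_measure)"
        using E by (intro integral_distr T) simp
      finally show ?thesis .
    qed
    also have "\<dots> = (\<integral>x. indicator E (T x) * inv_density x \<partial>unit_lborel)"
      by (rule integral_inv_measure[OF measurable_unit]) measurable
    also have "\<dots> = (\<integral>x. indicator E x * inv_density x \<partial>unit_lborel)"
      by (rule inv_density_invariant[OF ind, where D = 1]) (simp add: indicator_def)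
    also have "\<dots> = (\<integral>x. indicator E x \<partial>inv_measure)"
      by (rule integral_inv_measure[OF measurable_unit, symmetric]) measurable
    also have "\<dots> = measure inv_measure E"
      using sets.sets_into_space[OF E] by (simp add: Int_absorb2)
    finally show "emeasure (distr inv_measure inv_measure T) E = emeasure inv_measure E"
      by (simp add: I.emeasure_eq_measure finite_measure.emeasure_eq_measure
          prob_space.axioms I.prob_space_distr[OF T] prob_space.finite_measure)
  qed simp
qed (rule prob_space_inv_measure)

lemma acim_iterate:
  fixes \<phi> :: "real \<Rightarrow> real"
  assumes \<mu>: "acim T \<mu>" and \<phi>: "\<phi> \<in> borel_measurable \<mu>"
  shows "(\<integral>x. \<phi> ((T ^^ n) x) \<partial>\<mu>) = (\<integral>x. \<phi> x \<partial>\<mu>)"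
proof (induction n)
  case (Suc n)
  have T: "T \<in> measurable \<mu> \<mu>" and inv: "distr \<mu> \<mu> T = \<mu>" using \<mu> by (auto simp: acim_def)
  have Tn: "(T ^^ n) \<in> measurable \<mu> \<mu>" by (induction n) (use T in \<open>auto intro: measurable_comp\<close>)
  have "(\<integral>x. \<phi> ((T ^^ n) (T x)) \<partial>\<mu>) = (\<integral>x. \<phi> ((T ^^ n) x) \<partial>distr \<mu> \<mu> T)"
    using measurable_compose[OF Tn \<phi>] by (intro integral_distr[symmetric] T)
  then show ?case using Suc inv by (simp add: funpow_swap1)
qed simp

text \<open>For the density \<open>f\<close> of the given measure \<open>\<mu>\<close> and an indicator \<open>\<phi>\<close>, the sequence in the mixing
property is constantly \<open>measure \<mu> E\<close>.\<close>

lemma acim_unique: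
  assumes \<mu>: "acim T \<mu>" shows "\<mu> = inv_measure"
proof -
  interpret M: prob_space \<mu> using \<mu> by (simp add: acim_def)
  interpret I: prob_space inv_measure by (rule prob_space_inv_measure)
  have sets: "sets \<mu> = sets unit_lborel" and ac: "absolutely_continuous unit_lborel \<mu>"
    using \<mu> by (auto simp: acim_def)
  obtain f where f: "f \<in> borel_measurable unit_lborel" "AE x in unit_lborel. RN_deriv unit_lborel \<mu> x = ennreal (f x)"
      "\<And>x. 0 \<le> f x"
    using unit.real_RN_deriv[OF M.finite_measure_axioms ac sets] by metis
  have dens: "\<mu> = density unit_lborel (\<lambda>x. ennreal (f x))"
    using unit.density_RN_deriv[OF ac sets] density_cong[OF _ _ f(2)] f(1) by simp
  have int_f: "integrable unit_lborel f"
  proof (rule integrableI_nonneg[OF f(1)])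
    have "(\<integral>\<^sup>+x. ennreal (f x) \<partial>unit_lborel) = emeasure \<mu> (space \<mu>)"
      unfolding dens using f(1) by (subst emeasure_density) (auto intro!: nn_integral_cong simp: indicator_def)
    then show "(\<integral>\<^sup>+x. ennreal (f x) \<partial>unit_lborel) < \<infinity>" using M.emeasure_space_1 by simp
  qed (use f(3) in auto)
  have int_\<mu>: "(\<integral>x. g x \<partial>\<mu>) = (\<integral>x. g x * f x \<partial>unit_lborel)"
    if "g \<in> borel_measurable unit_lborel" for g :: "real \<Rightarrow> real"
    unfolding dens using that f by (subst integral_density) (auto simp: mult.commute)
  have f1: "(\<integral>x. f x \<partial>unit_lborel) = 1"
    using int_\<mu>[of "\<lambda>_. 1"] M.prob_space by simp
  show ?thesis
  proof (rule measure_eqI)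
    fix E assume E: "E \<in> sets \<mu>"
    then have E': "E \<in> sets borel" using sets sets_unit_iff by simp
    define \<phi> :: "real \<Rightarrow> real" where "\<phi> = indicator E"
    have \<phi>[measurable]: "\<phi> \<in> borel_measurable borel" unfolding \<phi>_def using E' by simp
    have D: "\<bar>\<phi> x\<bar> \<le> 1" for x unfolding \<phi>_def by (simp add: indicator_def)
    have "(\<integral>x. \<phi> ((T ^^ n) x) * f x \<partial>unit_lborel) = measure \<mu> E" for n
    proof -
      have "(\<lambda>x. \<phi> ((T ^^ n) x)) \<in> borel_measurable unit_lborel" by (rule measurable_unit) measurable
      then have "(\<integral>x. \<phi> ((T ^^ n) x) * f x \<partial>unit_lborel) = (\<integral>x. \<phi> ((T ^^ n) x) \<partial>\<mu>)"
        by (rule int_\<mu>[symmetric])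
      also have "\<dots> = (\<integral>x. \<phi> x \<partial>\<mu>)" unfolding \<phi>_def using E by (intro acim_iterate \<mu>) simp
      also have "\<dots> = measure \<mu> E" unfolding \<phi>_def using sets.sets_into_space[OF E] by (simp add: Int_absorb2)
      finally show ?thesis .
    qed
    moreover have "mixes \<phi> f" by (rule mixes_integrable[OF \<phi> _ int_f]) (rule D)
    ultimately have "measure \<mu> E = (\<integral>x. \<phi> x * inv_density x \<partial>unit_lborel)"
      unfolding mixes_def f1 by (simp add: LIMSEQ_const_iff)
    also have "\<dots> = (\<integral>x. \<phi> x \<partial>inv_measure)"
      by (rule integral_inv_measure[OF measurable_unit, symmetric]) measurable
    also have "\<dots> = measure inv_measure E"
    proof -
      have "E \<subseteq> space inv_measure" using E sets.sets_into_space[of E unit_lborel] sets by (simp add: inv_measure_def)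
      then show ?thesis unfolding \<phi>_def by (simp add: Int_absorb2)
    qed
    finally show "emeasure \<mu> E = emeasure inv_measure E"
      by (simp add: M.emeasure_eq_measure I.emeasure_eq_measure)
  qed (simp add: sets inv_measure_def)
qed

lemma the_acim:
  assumes "\<And>x. x \<in> {0..1} \<Longrightarrow> S x = T x"
  shows "(THE \<mu>. acim S \<mu>) = inv_measure"
proof -
  have eq: "acim S = acim T" by (intro ext acim_cong assms)
  show ?thesis
    unfolding eq
  proof (rule the_equality)
    show "acim T inv_measure" by (rule acim_inv_measure)
    show "\<mu> = inv_measure" if "acim T \<mu>" for \<mu> using that by (rule acim_unique)
  qed
qed

lemma RN_deriv_inv_measure_le:
  "AE x in unit_lborel. RN_deriv unit_lborel inv_measure x \<le> ennreal (1 + K)"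
proof -
  have "AE x in unit_lborel. ennreal (inv_density x) = RN_deriv unit_lborel inv_measure x"
    unfolding inv_measure_def by (rule unit.RN_deriv_unique) auto
  then show ?thesis
    using AE_space by eventually_elim (metis ennreal_leI inv_density_le space_unit)
qed

end

section \<open>Stability of the invariant density\<close>

lemma wmap_tendsto:
  assumes "A' \<longlonglongrightarrow> A" "B' \<longlonglongrightarrow> B" "l' \<longlonglongrightarrow> l" "m' \<longlonglongrightarrow> m" "t' \<longlonglongrightarrow> t" "x' \<longlonglongrightarrow> x"
    and "A \<noteq> 0" "B \<noteq> 0" "l \<noteq> 0" "m \<noteq> 0"
  shows "(\<lambda>n. wmap (A' n) (B' n) (l' n) (m' n) (t' n) (x' n)) \<longlonglongrightarrow> wmap A B l m t x"
  unfolding wmap_def by (intro tendsto_intros assms)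

context w_shape
begin

lemma inv_density_invariant_pow:
  fixes \<phi> :: "real \<Rightarrow> real"
  assumes [measurable]: "\<phi> \<in> borel_measurable borel" and D: "\<And>x. x \<in> {0..1} \<Longrightarrow> \<bar>\<phi> x\<bar> \<le> D"
  shows "(\<integral>x. \<phi> ((T ^^ N) x) * inv_density x \<partial>unit_lborel) = (\<integral>x. \<phi> x * inv_density x \<partial>unit_lborel)"
proof (induction N)
  case (Suc N)
  have "(\<integral>x. \<phi> ((T ^^ N) (T x)) * inv_density x \<partial>unit_lborel) = (\<integral>x. \<phi> ((T ^^ N) x) * inv_density x \<partial>unit_lborel)"
    by (rule inv_density_invariant[where D = D]) (measurable, intro D T_pow_unit)
  then show ?case using Suc by (simp add: funpow_swap1)
qed simp

text \<open>Write \<open>T'\<close> and \<open>inv_density'\<close> for a nearby map and its invariant density. The mean of \<open>\<phi>\<close> under \<open>inv_density'\<close> equals the mean of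
\<open>\<phi> \<circ> T' ^^ N\<close>, which differs little from that of \<open>\<phi> \<circ> T ^^ N\<close>: the two functions converge pointwise, and \<open>inv_density'\<close> is
bounded by \<open>1 + K\<close>. The latter mean is that of \<open>\<phi>\<close> under the image of \<open>inv_density'\<close> by \<open>P ^^ N\<close>, and \<open>N\<close> can be chosen, independently of
the nearby map, so that this image is close to the invariant density of \<open>T\<close>. All this uses that both maps have the same
constants \<open>\<eta>\<close> and \<open>\<delta>\<close>, hence the same class of densities.\<close>

lemma invariant_density_stable:
  fixes \<phi> :: "real \<Rightarrow> real" and A' B' l' m' t' :: "nat \<Rightarrow> real"
  assumes W: "\<And>n. w_shape (A' n) (B' n) (l' n) (m' n) (t' n) \<eta> \<delta>"
    and lim: "A' \<longlonglongrightarrow> A" "B' \<longlonglongrightarrow> B" "l' \<longlonglongrightarrow> l" "m' \<longlonglongrightarrow> m" "t' \<longlonglongrightarrow> t"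
    and cont: "continuous_on UNIV \<phi>" and D: "\<And>x. x \<in> {0..1} \<Longrightarrow> \<bar>\<phi> x\<bar> \<le> D"
  shows "(\<lambda>n. \<integral>x. \<phi> x * w_shape.inv_density (A' n) (B' n) (l' n) (m' n) (t' n) x \<partial>unit_lborel)
    \<longlonglongrightarrow> (\<integral>x. \<phi> x * inv_density x \<partial>unit_lborel)"
proof -
  define T' where "T' n = wmap (A' n) (B' n) (l' n) (m' n) (t' n)" for n
  define P' where "P' n = transfer (A' n) (B' n) (l' n) (m' n) (t' n)" for n
  define inv_density' where "inv_density' n = w_shape.inv_density (A' n) (B' n) (l' n) (m' n) (t' n)" for n
  have \<phi>[measurable]: "\<phi> \<in> borel_measurable borel"
    using cont by (rule borel_measurable_continuous_onI)
  have D0: "0 \<le> D" by (rule order_trans[OF abs_ge_zero D[of 0]]) simp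
  have K0: "0 \<le> 1 + K" using K_ge_1 by simp
  have T'm[measurable]: "(T' n ^^ N) \<in> borel_measurable borel" for n N
    unfolding T'_def by (rule w_shape.T_pow_measurable[OF W])
  have T'u: "(T' n ^^ N) x \<in> {0..1}" if "x \<in> {0..1}" for n N x
    unfolding T'_def by (rule w_shape.T_pow_unit[OF W that])
  have inv_density'm[measurable]: "inv_density' n \<in> borel_measurable borel" for n
    unfolding inv_density'_def by (rule w_shape.inv_density_measurable[OF W])
  have inv_density'0: "0 \<le> inv_density' n x" and inv_density'K: "inv_density' n x \<le> 1 + K" if "x \<in> {0..1}" for n x
    unfolding inv_density'_def using w_shape.inv_density_nonneg[OF W that] w_shape.inv_density_le[OF W that] by auto
  have f': "bv_density K ((P' n ^^ j) (\<lambda>_. 1))" for n j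
    unfolding P'_def by (rule w_shape.P_pow_one[OF W])

  have orbit: "(\<lambda>n. (T' n ^^ N) x) \<longlonglongrightarrow> (T ^^ N) x" for N x
  proof (induction N)
    case (Suc N)
    show ?case unfolding funpow.simps o_apply T'_def
      using wmap_tendsto[OF lim Suc[unfolded T'_def]] A0 B0 l0 m0 by simp
  qed simp
  have gap: "(\<lambda>n. \<integral>x. \<bar>\<phi> ((T' n ^^ N) x) - \<phi> ((T ^^ N) x)\<bar> \<partial>unit_lborel) \<longlonglongrightarrow> 0" for N
  proof -
    have "(\<lambda>n. \<integral>x. \<bar>\<phi> ((T' n ^^ N) x) - \<phi> ((T ^^ N) x)\<bar> \<partial>unit_lborel) \<longlonglongrightarrow> (\<integral>x. 0 \<partial>unit_lborel :: real)"
    proof (rule dominated_unit[where C = "D + D"])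
      fix x :: real assume x: "x \<in> {0..1}"
      have "isCont \<phi> ((T ^^ N) x)" using cont by (simp add: continuous_on_eq_continuous_at)
      then have "(\<lambda>n. \<phi> ((T' n ^^ N) x)) \<longlonglongrightarrow> \<phi> ((T ^^ N) x)" by (rule isCont_tendsto_compose[OF _ orbit])
      from tendsto_rabs[OF tendsto_diff[OF this tendsto_const[of "\<phi> ((T ^^ N) x)"]]]
      show "(\<lambda>n. \<bar>\<phi> ((T' n ^^ N) x) - \<phi> ((T ^^ N) x)\<bar>) \<longlonglongrightarrow> 0" by simp
      show "\<bar>\<bar>\<phi> ((T' n ^^ N) x) - \<phi> ((T ^^ N) x)\<bar>\<bar> \<le> D + D" for n
        using D[OF T'u[OF x, of N n]] D[OF T_pow_unit[OF x, of N]] by linarith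
    qed measurable
    then show ?thesis by simp
  qed
  show ?thesis
  proof (rule LIMSEQ_I)
    fix e :: real assume e: "0 < e"
    define e1 where "e1 = e / (2 * (D + 1))"
    have e1: "0 < e1" "D * e1 < e / 2" unfolding e1_def using e D0 by (auto simp: field_simps)
    from P_pow_uniform_limit[OF e1(1)] obtain N where
      "\<forall>n\<ge>N. \<forall>f. bv_density K f \<longrightarrow> (\<forall>x\<in>{0..1}. \<bar>(P ^^ n) f x - inv_density x\<bar> \<le> e1)" ..
    then have N: "\<bar>(P ^^ N) f x - inv_density x\<bar> \<le> e1" if "bv_density K f" "x \<in> {0..1}" for f x
      using that by simp
    have near: "\<bar>(\<integral>x. \<phi> ((T ^^ N) x) * inv_density' n x \<partial>unit_lborel) - (\<integral>x. \<phi> x * inv_density x \<partial>unit_lborel)\<bar> \<le> D * e1" for n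
    proof -
      \<comment> \<open>The nearby invariant density is replaced by its approximations, which are known to lie in the class.\<close>
      have step: "\<bar>(\<integral>x. \<phi> ((T ^^ N) x) * (P' n ^^ j) (\<lambda>_. 1) x \<partial>unit_lborel) - (\<integral>x. \<phi> x * inv_density x \<partial>unit_lborel)\<bar> \<le> D * e1" for j
      proof -
        define f where "f = (P' n ^^ j) (\<lambda>_. 1)"
        have f: "bv_density K f" unfolding f_def by (rule f')
        have Pf: "bv_density K ((P ^^ N) f)" by (rule bv_density_P_pow[OF f])
        have [measurable]: "(P ^^ N) f \<in> borel_measurable borel" by (rule bv_density_measurable[OF Pf])
        have i1: "integrable unit_lborel (\<lambda>x. \<phi> x * (P ^^ N) f x)"
        proof (rule integrable_unit_bounded[where C = "D * (1 + K)"])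
          show "\<bar>\<phi> x * (P ^^ N) f x\<bar> \<le> D * (1 + K)" if "x \<in> {0..1}" for x
            unfolding abs_mult by (rule mult_mono[OF D[OF that] bv_density_abs_le[OF Pf that] D0]) simp
        qed measurable
        have i2: "integrable unit_lborel (\<lambda>x. \<phi> x * inv_density x)"
        proof (rule integrable_unit_bounded[where C = "D * (1 + K)"])
          show "\<bar>\<phi> x * inv_density x\<bar> \<le> D * (1 + K)" if "x \<in> {0..1}" for x
            unfolding abs_mult using inv_density_nonneg[OF that] inv_density_le[OF that]
            by (intro mult_mono[OF D[OF that] _ D0]) auto
        qed measurable
        have dual: "(\<integral>x. \<phi> ((T ^^ N) x) * f x \<partial>unit_lborel) = (\<integral>x. \<phi> x * (P ^^ N) f x \<partial>unit_lborel)"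
          by (rule duality_pow[OF f \<phi>]) (rule D)
        have "\<bar>(\<integral>x. \<phi> x * (P ^^ N) f x \<partial>unit_lborel) - (\<integral>x. \<phi> x * inv_density x \<partial>unit_lborel)\<bar>
            = \<bar>\<integral>x. \<phi> x * (P ^^ N) f x - \<phi> x * inv_density x \<partial>unit_lborel\<bar>"
          using i1 i2 by simp
        also have "\<dots> \<le> (\<integral>x. \<bar>\<phi> x * (P ^^ N) f x - \<phi> x * inv_density x\<bar> \<partial>unit_lborel)"
          by (rule integral_abs_bound)
        also have "\<dots> \<le> (\<integral>x. D * e1 \<partial>unit_lborel)"
        proof (rule integral_unit_mono)
          show "\<bar>\<phi> x * (P ^^ N) f x - \<phi> x * inv_density x\<bar> \<le> D * e1" if "x \<in> {0..1}" for x
            unfolding right_diff_distrib[symmetric] abs_mult by (rule mult_mono[OF D[OF that] N[OF f that] D0]) simp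
        qed (use i1 i2 in auto)
        finally show ?thesis unfolding f_def[symmetric] dual using unit.prob_space by simp
      qed
      have "(\<lambda>j. \<integral>x. \<phi> ((T ^^ N) x) * (P' n ^^ j) (\<lambda>_. 1) x \<partial>unit_lborel) \<longlonglongrightarrow> (\<integral>x. \<phi> ((T ^^ N) x) * inv_density' n x \<partial>unit_lborel)"
        unfolding P'_def inv_density'_def
      proof (rule w_shape.integral_P_pow_tendsto[OF W bv_density_one])
        show "(\<lambda>x. \<phi> ((T ^^ N) x)) \<in> borel_measurable borel" by measurable
        show "\<bar>\<phi> ((T ^^ N) x)\<bar> \<le> D" if "x \<in> {0..1}" for x by (rule D[OF T_pow_unit[OF that]])
      qed
      from tendsto_rabs[OF tendsto_diff[OF this tendsto_const[of "\<integral>x. \<phi> x * inv_density x \<partial>unit_lborel"]]]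
      show ?thesis by (rule LIMSEQ_le_const2) (use step in blast)
    qed
    have "(\<lambda>n. (1 + K) * (\<integral>x. \<bar>\<phi> ((T' n ^^ N) x) - \<phi> ((T ^^ N) x)\<bar> \<partial>unit_lborel)) \<longlonglongrightarrow> (1 + K) * 0"
      by (intro tendsto_mult tendsto_const gap)
    from LIMSEQ_D[OF this, of "e / 2"] e obtain n0 where
      n0: "\<And>n. n0 \<le> n \<Longrightarrow> (1 + K) * (\<integral>x. \<bar>\<phi> ((T' n ^^ N) x) - \<phi> ((T ^^ N) x)\<bar> \<partial>unit_lborel) < e / 2"
      by (fastforce simp: abs_less_iff)
    have "norm ((\<integral>x. \<phi> x * inv_density' n x \<partial>unit_lborel) - (\<integral>x. \<phi> x * inv_density x \<partial>unit_lborel)) < e" if "n0 \<le> n" for n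
    proof -
      have inv: "(\<integral>x. \<phi> x * inv_density' n x \<partial>unit_lborel) = (\<integral>x. \<phi> ((T' n ^^ N) x) * inv_density' n x \<partial>unit_lborel)"
        unfolding inv_density'_def T'_def by (rule w_shape.inv_density_invariant_pow[OF W \<phi>, symmetric]) (rule D)
      have bound: "\<bar>\<psi> x * inv_density' n x\<bar> \<le> D * (1 + K)" if "\<bar>\<psi> x\<bar> \<le> D" "x \<in> {0..1}" for \<psi> x
        unfolding abs_mult using inv_density'0[OF that(2)] inv_density'K[OF that(2)]
        by (intro mult_mono[OF that(1) _ D0]) auto
      have i1: "integrable unit_lborel (\<lambda>x. \<phi> ((T' n ^^ N) x) * inv_density' n x)"
      proof (rule integrable_unit_bounded[where C = "D * (1 + K)"])
        show "\<bar>\<phi> ((T' n ^^ N) x) * inv_density' n x\<bar> \<le> D * (1 + K)" if "x \<in> {0..1}" for x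
          by (rule bound[where \<psi> = "\<lambda>x. \<phi> ((T' n ^^ N) x)", OF D[OF T'u[OF that]] that])
      qed measurable
      have i2: "integrable unit_lborel (\<lambda>x. \<phi> ((T ^^ N) x) * inv_density' n x)"
      proof (rule integrable_unit_bounded[where C = "D * (1 + K)"])
        show "\<bar>\<phi> ((T ^^ N) x) * inv_density' n x\<bar> \<le> D * (1 + K)" if "x \<in> {0..1}" for x
          by (rule bound[where \<psi> = "\<lambda>x. \<phi> ((T ^^ N) x)", OF D[OF T_pow_unit[OF that]] that])
      qed measurable
      have i3: "integrable unit_lborel (\<lambda>x. \<bar>\<phi> ((T' n ^^ N) x) - \<phi> ((T ^^ N) x)\<bar>)"
      proof (rule integrable_unit_bounded[where C = "D + D"])
        show "\<bar>\<bar>\<phi> ((T' n ^^ N) x) - \<phi> ((T ^^ N) x)\<bar>\<bar> \<le> D + D" if x: "x \<in> {0..1}" for x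
          using D[OF T'u[OF x, of N n]] D[OF T_pow_unit[OF x, of N]] by linarith
      qed measurable
      have "\<bar>(\<integral>x. \<phi> ((T' n ^^ N) x) * inv_density' n x \<partial>unit_lborel) - (\<integral>x. \<phi> ((T ^^ N) x) * inv_density' n x \<partial>unit_lborel)\<bar>
          = \<bar>\<integral>x. \<phi> ((T' n ^^ N) x) * inv_density' n x - \<phi> ((T ^^ N) x) * inv_density' n x \<partial>unit_lborel\<bar>"
        using i1 i2 by simp
      also have "\<dots> \<le> (\<integral>x. \<bar>\<phi> ((T' n ^^ N) x) * inv_density' n x - \<phi> ((T ^^ N) x) * inv_density' n x\<bar> \<partial>unit_lborel)"
        by (rule integral_abs_bound)
      also have "\<dots> \<le> (\<integral>x. (1 + K) * \<bar>\<phi> ((T' n ^^ N) x) - \<phi> ((T ^^ N) x)\<bar> \<partial>unit_lborel)"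
      proof (rule integral_unit_mono)
        show "\<bar>\<phi> ((T' n ^^ N) x) * inv_density' n x - \<phi> ((T ^^ N) x) * inv_density' n x\<bar>
            \<le> (1 + K) * \<bar>\<phi> ((T' n ^^ N) x) - \<phi> ((T ^^ N) x)\<bar>" if "x \<in> {0..1}" for x
          unfolding left_diff_distrib[symmetric] abs_mult using inv_density'0[OF that] inv_density'K[OF that]
          by (subst mult.commute) (intro mult_right_mono, auto)
      qed (use i1 i2 i3 in auto)
      also have "\<dots> < e / 2" using n0[OF that] by simp
      finally show ?thesis unfolding inv real_norm_def using near[of n] e1(2) by linarith
    qed
    then show "\<exists>n0. \<forall>n\<ge>n0. norm ((\<integral>x. \<phi> x * w_shape.inv_density (A' n) (B' n) (l' n) (m' n) (t' n) x \<partial>unit_lborel)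
        - (\<integral>x. \<phi> x * inv_density x \<partial>unit_lborel)) < e"
      unfolding inv_density'_def by blast
  qed
qed

end

section \<open>The family of the theorem\<close>

context
  fixes s1 s2 p q r :: real
  assumes s1: "s1 > 1" and s2: "s2 > 1" and harmonic: "1 / s1 + 1 / s2 < 1"
    and p: "p > 0" and q: "q > 0" and r: "r > 0"
begin

definition inv_slopeL where "inv_slopeL a = 1 / (s1 + p * a)"
definition inv_slopeR where "inv_slopeR a = 1 / (s2 + q * a)"
definition peak where "peak a = 1/2 + r * a"
definition widthL where "widthL a = 1/2 - inv_slopeL a * peak a"
definition widthR where "widthR a = 1/2 - inv_slopeR a * peak a"

definition amax where "amax = min 1 (min (1 / (2 * r)) (min ((s1 - 1) / (2 * r)) ((s2 - 1) / (2 * r))))"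
text \<open>As the slopes grow with \<open>a\<close>, the sum of the inverse middle slopes is largest at \<open>a = 0\<close>, while the lengths
of the middle pieces stay bounded below for \<open>a \<le> 1\<close>. So one pair of constants serves all small
parameters.\<close>

definition eta where "eta = max (1 / s1 + 1 / s2) (1/2)"
definition delta where "delta = min (1 / (s1 + p) * (1/2)) (1 / (s2 + q) * (1/2))"

lemma amax_pos: "0 < amax"
  unfolding amax_def using s1 s2 r by simp

lemma W_shape:
  assumes a: "0 \<le> a" "a < amax"
  shows "w_shape (inv_slopeL a) (inv_slopeR a) (widthL a) (widthR a) (peak a) eta delta"
proof
  have ra: "a < 1" "2 * r * a < 1" "2 * r * a < s1 - 1" "2 * r * a < s2 - 1"
    using a r unfolding amax_def by (auto simp: field_simps)
  have pa: "0 \<le> p * a" "0 \<le> q * a" "0 \<le> r * a" "p * a \<le> p" "q * a \<le> q"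
    using a p q r ra by (auto simp: mult_left_le)
  show "0 < inv_slopeL a" "0 < inv_slopeR a" unfolding inv_slopeL_def inv_slopeR_def using s1 s2 pa by auto
  show "0 < widthL a" "0 < widthR a"
    unfolding widthL_def widthR_def inv_slopeL_def inv_slopeR_def peak_def
    using s1 s2 pa ra by (auto simp: field_simps)
  show "0 < delta" unfolding delta_def using s1 s2 p q by simp
  show "1/2 \<le> peak a" "peak a < 1" unfolding peak_def using pa ra by auto
  show "widthL a + inv_slopeL a * peak a = 1/2" "widthR a + inv_slopeR a * peak a = 1/2"
    unfolding widthL_def widthR_def by auto
  have "inv_slopeL a \<le> 1 / s1" "inv_slopeR a \<le> 1 / s2"
    unfolding inv_slopeL_def inv_slopeR_def using s1 s2 pa by (auto intro!: divide_left_mono mult_pos_pos)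
  then show "inv_slopeL a + inv_slopeR a \<le> eta" unfolding eta_def by linarith
  show "1/2 \<le> eta" "eta < 1" unfolding eta_def using harmonic by auto
  have "1 / (s1 + p) * (1/2) \<le> inv_slopeL a * peak a"
    unfolding inv_slopeL_def peak_def using s1 p pa
    by (intro mult_mono) (auto intro!: divide_left_mono mult_pos_pos)
  then show "delta \<le> inv_slopeL a * peak a" unfolding delta_def by (rule min.coboundedI1)
  have "1 / (s2 + q) * (1/2) \<le> inv_slopeR a * peak a"
    unfolding inv_slopeR_def peak_def using s2 q pa
    by (intro mult_mono) (auto intro!: divide_left_mono mult_pos_pos)
  then show "delta \<le> inv_slopeR a * peak a" unfolding delta_def by (rule min.coboundedI2)
qed

lemma W_map_eq:
  assumes a: "0 \<le> a" "a < amax" and x: "x \<in> {0..1}"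
  shows "W_map s1 s2 p q r a x = wmap (inv_slopeL a) (inv_slopeR a) (widthL a) (widthR a) (peak a) x"
proof -
  interpret w_shape "inv_slopeL a" "inv_slopeR a" "widthL a" "widthR a" "peak a" eta delta
    by (rule W_shape[OF a])
  have nz: "0 < s1 + p * a" "0 < s2 + q * a"
    using A0 B0 unfolding inv_slopeL_def inv_slopeR_def by (simp_all add: zero_less_divide_iff)
  have L: "1/2 - (1/2 + r * a) / (s1 + p * a) = widthL a"
    unfolding widthL_def inv_slopeL_def peak_def by simp
  have R: "1/2 + (1/2 + r * a) / (s2 + q * a) = 1 - widthR a"
    unfolding widthR_def inv_slopeR_def peak_def by simp
  have inverse_width: "1 / (1/2 - (1/2 + r * a) / S) = 2 * S / (S - 1 - 2 * r * a)" if "0 < S" for S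
  proof -
    have "1/2 - (1/2 + r * a) / S = (S - 1 - 2 * r * a) / (2 * S)" using that by (simp add: field_simps)
    then show ?thesis by simp
  qed
  have "widthR a = 1/2 - (1/2 + r * a) / (s2 + q * a)" using R by linarith
  then have sL: "2 * (s1 + p * a) / (s1 - 1 + p * a - 2 * r * a) = 1 / widthL a"
    and sR: "2 * (s2 + q * a) / (s2 - 1 + q * a - 2 * r * a) = 1 / widthR a"
    using inverse_width[OF nz(1)] inverse_width[OF nz(2)] L
    by (simp_all only: add_diff_eq diff_add_eq)
  have A: "inv_slopeL a = 1 / (s1 + p * a)" and B: "inv_slopeR a = 1 / (s2 + q * a)" by (simp_all add: inv_slopeL_def inv_slopeR_def)
  consider "x < widthL a" | "widthL a \<le> x" "x < 1/2" | "1/2 \<le> x" "x < 1 - widthR a" | "1 - widthR a \<le> x"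
    by linarith
  then show ?thesis
  proof cases
    case 1
    then have "W_map s1 s2 p q r a x = 1 - 1 / widthL a * x" unfolding W_map_def L R sL sR by simp
    then show ?thesis using T_left[of x] 1 x by simp
  next
    case 2
    then have "W_map s1 s2 p q r a x = (s1 + p * a) * (x - 1/2) + 1/2 + r * a"
      unfolding W_map_def L R sL sR by simp
    also have "\<dots> = peak a - (1/2 - x) / inv_slopeL a" unfolding A peak_def by (simp add: algebra_simps)
    finally show ?thesis using T_midleft[of x] 2 by simp
  next
    case 3
    then have "W_map s1 s2 p q r a x = - (s2 + q * a) * (x - 1/2) + 1/2 + r * a"
      unfolding W_map_def L R sL sR using l_half by simp
    also have "\<dots> = peak a - (x - 1/2) / inv_slopeR a" unfolding B peak_def by (simp add: algebra_simps)
    finally show ?thesis using T_midright[of x] 3 by simp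
  next
    case 4
    then have "W_map s1 s2 p q r a x = 1 + 1 / widthR a * (x - 1)"
      unfolding W_map_def L R sL sR using l_half m_half by simp
    also have "\<dots> = 1 - (1 - x) / widthR a" by (simp add: diff_divide_distrib)
    finally show ?thesis using T_right[of x] 4 x by simp
  qed
qed

definition W_inv_density where
  "W_inv_density a = w_shape.inv_density (inv_slopeL a) (inv_slopeR a) (widthL a) (widthR a) (peak a)"

lemma W_measure_eq:
  assumes a: "0 \<le> a" "a < amax"
  shows "W_measure s1 s2 p q r a = w_shape.inv_measure (inv_slopeL a) (inv_slopeR a) (widthL a) (widthR a) (peak a)"
  unfolding W_measure_def by (rule w_shape.the_acim[OF W_shape[OF a] W_map_eq[OF a]])

lemma W_density_le:
  assumes a: "0 < a" "a < amax"
  shows "AE x in unit_lborel. W_density s1 s2 p q r a x \<le> ennreal (1 + w_shape.K eta delta)"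
  using w_shape.RN_deriv_inv_measure_le[OF W_shape, of a] a
  unfolding W_density_def by (simp add: W_measure_eq)

lemma W_measure_integral:
  fixes f :: "real \<Rightarrow> real"
  assumes a: "0 \<le> a" "a < amax" and g: "g \<in> borel_measurable borel" "\<And>x. x \<in> {0..1} \<Longrightarrow> f x = g x"
  shows "(\<integral>x. f x \<partial>W_measure s1 s2 p q r a) = (\<integral>x. g x * W_inv_density a x \<partial>unit_lborel)"
proof -
  interpret w_shape "inv_slopeL a" "inv_slopeR a" "widthL a" "widthR a" "peak a" eta delta
    by (rule W_shape[OF a])
  have "(\<integral>x. f x \<partial>inv_measure) = (\<integral>x. g x \<partial>inv_measure)"
    by (intro Bochner_Integration.integral_cong) (simp_all add: inv_measure_def g(2))
  then show ?thesis
    unfolding W_measure_eq[OF a] W_inv_density_def integral_inv_measure[OF measurable_unit[OF g(1)]] .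
qed

lemma W_measure_integral_tendsto:
  fixes f :: "real \<Rightarrow> real"
  assumes f: "continuous_on {0..1} f"
  shows "((\<lambda>a. \<integral>x. f x \<partial>W_measure s1 s2 p q r a) \<longlongrightarrow> (\<integral>x. f x \<partial>W_measure s1 s2 p q r 0)) (at_right 0)"
  unfolding tendsto_at_iff_sequentially
proof (intro allI impI)
  fix X :: "nat \<Rightarrow> real"
  assume X0: "\<forall>i. X i \<in> {0<..} - {0}" and X: "X \<longlonglongrightarrow> 0"
  define g where "g x = f (max 0 (min 1 x))" for x
  have g: "continuous_on UNIV g"
    unfolding g_def by (rule continuous_on_compose2[OF f]) (auto intro!: continuous_intros)
  have gm: "g \<in> borel_measurable borel" using g by (rule borel_measurable_continuous_onI)
  have fg: "f x = g x" if "x \<in> {0..1}" for x using that unfolding g_def by simp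
  obtain D where D: "\<And>x. x \<in> {0..1} \<Longrightarrow> \<bar>g x\<bar> \<le> D"
  proof -
    have "compact (g ` {0..1})" using g by (intro compact_continuous_image) (auto intro: continuous_on_subset)
    then have "bounded (g ` {0..1})" by (rule compact_imp_bounded)
    then obtain D where "\<forall>x\<in>{0..1}. \<bar>g x\<bar> \<le> D" unfolding bounded_iff by auto
    then show ?thesis using that[of D] by blast
  qed
  have "eventually (\<lambda>i. X i < amax) sequentially" using order_tendstoD(2)[OF X amax_pos] .
  then obtain k where k: "\<And>i. k \<le> i \<Longrightarrow> X i < amax" by (auto simp: eventually_sequentially)
  define Y where "Y i = X (i + k)" for i
  have Y: "0 \<le> Y i" "Y i < amax" for i using X0 k[of "i + k"] unfolding Y_def by (auto simp: less_imp_le)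
  have Ylim: "Y \<longlonglongrightarrow> 0" unfolding Y_def by (rule LIMSEQ_ignore_initial_segment[OF X])
  have A: "(\<lambda>i. inv_slopeL (Y i)) \<longlonglongrightarrow> inv_slopeL 0" and B: "(\<lambda>i. inv_slopeR (Y i)) \<longlonglongrightarrow> inv_slopeR 0"
    and t: "(\<lambda>i. peak (Y i)) \<longlonglongrightarrow> peak 0"
    unfolding inv_slopeL_def inv_slopeR_def peak_def by (intro tendsto_intros Ylim; use s1 s2 in simp)+
  have "(\<lambda>i. \<integral>x. g x * W_inv_density (Y i) x \<partial>unit_lborel) \<longlonglongrightarrow> (\<integral>x. g x * W_inv_density 0 x \<partial>unit_lborel)"
    unfolding W_inv_density_def
  proof (rule w_shape.invariant_density_stable[OF W_shape[OF order_refl amax_pos]])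
    show "w_shape (inv_slopeL (Y n)) (inv_slopeR (Y n)) (widthL (Y n)) (widthR (Y n)) (peak (Y n)) eta delta" for n
      by (rule W_shape[OF Y])
    show "(\<lambda>i. widthL (Y i)) \<longlonglongrightarrow> widthL 0" "(\<lambda>i. widthR (Y i)) \<longlonglongrightarrow> widthR 0"
      unfolding widthL_def widthR_def by (intro tendsto_intros A B t)+
  qed (fact A B t g D)+
  moreover have "(\<integral>x. f x \<partial>W_measure s1 s2 p q r a) = (\<integral>x. g x * W_inv_density a x \<partial>unit_lborel)"
    if "0 \<le> a" "a < amax" for a
    by (rule W_measure_integral[OF that gm fg])
  ultimately have "(\<lambda>i. \<integral>x. f x \<partial>W_measure s1 s2 p q r (Y i)) \<longlonglongrightarrow> (\<integral>x. f x \<partial>W_measure s1 s2 p q r 0)"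
    using Y amax_pos by simp
  then have "(\<lambda>i. \<integral>x. f x \<partial>W_measure s1 s2 p q r (X i)) \<longlonglongrightarrow> (\<integral>x. f x \<partial>W_measure s1 s2 p q r 0)"
    unfolding Y_def by (rule LIMSEQ_offset)
  then show "((\<lambda>a. \<integral>x. f x \<partial>W_measure s1 s2 p q r a) \<circ> X) \<longlonglongrightarrow> (\<integral>x. f x \<partial>W_measure s1 s2 p q r 0)"
    by (simp add: o_def)
qed

end

theorem theorem2:
  fixes s1 s2 p q r :: real
  assumes "s1 > 1" and "s2 > 1" and "1 / s1 + 1 / s2 < 1"
    and "p > 0" and "q > 0" and "r > 0"
  shows "(\<exists>a0>0. \<exists>M::real. \<forall>a. 0 < a \<and> a < a0 \<longrightarrow>
            (AE x in unit_lborel. W_density s1 s2 p q r a x \<le> ennreal M)) \<and>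
         (\<forall>f :: real \<Rightarrow> real. continuous_on {0..1} f \<longrightarrow>
            ((\<lambda>a. \<integral>x. f x \<partial>(W_measure s1 s2 p q r a)) \<longlongrightarrow>
               (\<integral>x. f x \<partial>(W_measure s1 s2 p q r 0))) (at_right 0))"
  using amax_pos[OF assms] W_density_le[OF assms] W_measure_integral_tendsto[OF assms] by blast

end
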